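(* Let $q$ be a prime power, let $N,D$ be integers with $D\ge 3$ and $N\ge 2D$, let $\Gamma=J_q(N,D)$ be the Grassmann graph, let $C$ be a Delsarte clique of $\Gamma$ and let $x\in C$. Let $\mathbf T=\mathbf T(x,C)$ be the generalized Terwilliger algebra of $\Gamma$ with respect to $x,C$, and let $\mathbf W\subseteq\mathbb C^X$ be the $2D$-dimensional $\mathbf T$-module spanned by the characteristic vectors $\hat C^-_0,\hat C^+_0,\hat C^-_1,\hat C^+_1,\dots,\hat C^-_{D-1},\hat C^+_{D-1}$. Then the $\mathbf T$-module $\mathbf W$ is irreducible.
   Context: Write $[n]:=\frac{q^n-1}{q-1}$. The Grassmann graph $\Gamma=J_q(N,D)$ has as vertex set $X$ all $D$-dimensional subspaces of an $N$-dimensional vector space over $\mathbb F_q$; two vertices are adjacent iff their intersection has dimension $D-1$. $\partial$ is the path-length distance; $\Gamma$ has diameter $D$. A Delsarte clique is a clique $C$ attaining the Hoffman bound, i.e. $|C|=1-\theta_0/\theta_D=[N-D+1]$, where $\theta_0$ and $\theta_D$ are the largest and smallest eigenvalues of the adjacency matrix (e.g. all $D$-dimensional subspaces containing a fixed $(D-1)$-dimensional subspace). For $0\le i\le D-1$ put $C_i=\{y\in X:\partial(y,C)=i\}$, where $\partial(y,C)=\min_{z\in C}\partial(y,z)$, and $$C^-_i=\{y\in C_i:\partial(x,y)=i\},\qquad C^+_i=\{y\in C_i:\partial(x,y)=i+1\}.$$ The sets $C_i^\pm$ ($0\le i\le D-1$) form a partition of $X$ into nonempty cells. For $Y\subseteq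 X$, $\hat Y\in\mathbb C^X$ denotes the characteristic vector. $A\in\mathrm{Mat}_X(\mathbb C)$ is the adjacency matrix. For $0\le i\le D$, $E^*_i\in\mathrm{Mat}_X(\mathbb C)$ is the diagonal matrix with $(y,y)$-entry $1$ if $\partial(x,y)=i$ and $0$ otherwise. For $0\le i\le D-1$, $\widetilde E^*_i$ is the diagonal matrix with $(y,y)$-entry $1$ if $y\in C_i$ and $0$ otherwise. The algebra $\mathbf T=\mathbf T(x,C)$ is the subalgebra of $\mathrm{Mat}_X(\mathbb C)$ generated by $A$, all $E^*_i$ ($0\le i\le D$), and all $\widetilde E^*_i$ ($0\le i\le D-1$). The subspace $\mathbf W$ is invariant under $\mathbf T$. *)

theory Defs
  imports Complex_Main "HOL-Library.Function_Algebras" "HOL-Library.Cardinality"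
    "HOL-Number_Theory.Prime_Powers"
begin

text \<open>
  The ambient vector space is an arbitrary one: a type \<open>'v\<close> with a scalar multiplication
  \<open>scale\<close> by a field \<open>'f\<close>. Graphs are given by a vertex set \<open>X\<close> and a set \<open>E\<close> of
  (ordered) pairs of adjacent vertices.
\<close>

definition grassmann_verts :: "('f::field \<Rightarrow> 'v::ab_group_add \<Rightarrow> 'v) \<Rightarrow> nat \<Rightarrow> 'v set set" where
  "grassmann_verts scale D = {U. module.subspace scale U \<and> vector_space.dim scale U = D}"

definition grassmann_edges ::
    "('f::field \<Rightarrow> 'v::ab_group_add \<Rightarrow> 'v) \<Rightarrow> nat \<Rightarrow> ('v set \<times> 'v set) set" where
  "grassmann_edges scale D =
     {(U, U'). U \<in> grassmann_verts scale D \<and> U' \<in> grassmann_verts scale D \<and>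
               vector_space.dim scale (U \<inter> U') = D - 1}"

text \<open>The distance is meaningful only for vertices joined by a walk.\<close>

definition gdist :: "('x \<times> 'x) set \<Rightarrow> 'x \<Rightarrow> 'x \<Rightarrow> nat" where
  "gdist E y z = (LEAST n. (y, z) \<in> E ^^ n)"

definition gdist_set :: "('x \<times> 'x) set \<Rightarrow> 'x \<Rightarrow> 'x set \<Rightarrow> nat" where
  "gdist_set E y C = Min (gdist E y ` C)"

definition is_clique :: "'x set \<Rightarrow> ('x \<times> 'x) set \<Rightarrow> 'x set \<Rightarrow> bool" where
  "is_clique X E C \<longleftrightarrow> C \<subseteq> X \<and> (\<forall>y\<in>C. \<forall>z\<in>C. y \<noteq> z \<longrightarrow> (y, z) \<in> E)"

text \<open>
  Vectors in \<open>\<complex>\<^sup>X\<close> and matrices in \<open>Mat\<^sub>X(\<complex>)\<close> are functions that vanish outside \<open>X\<close> and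
  \<open>X \<times> X\<close>, respectively; sums and zero are the pointwise ones of
  \<^theory>\<open>HOL-Library.Function_Algebras\<close>. The pointwise product of that theory is not used.
\<close>

definition cvecs :: "'x set \<Rightarrow> ('x \<Rightarrow> complex) set" where
  "cvecs X = {v. \<forall>y. y \<notin> X \<longrightarrow> v y = 0}"

definition cvec_scale :: "complex \<Rightarrow> ('x \<Rightarrow> complex) \<Rightarrow> 'x \<Rightarrow> complex" where
  "cvec_scale c v = (\<lambda>y. c * v y)"

lemma vector_space_cvec_scale: "vector_space cvec_scale"
  by unfold_locales (auto simp: cvec_scale_def fun_eq_iff algebra_simps)

definition char_vec :: "'x set \<Rightarrow> 'x \<Rightarrow> complex" where
  "char_vec Y = (\<lambda>y. of_bool (y \<in> Y))"

definition mat_vec :: "'x set \<Rightarrow> ('x \<Rightarrow> 'x \<Rightarrow> complex) \<Rightarrow> ('x \<Rightarrow> complex) \<Rightarrow> 'x \<Rightarrow> complex" where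
  "mat_vec X M v = (\<lambda>y. \<Sum>z\<in>X. M y z * v z)"

definition mat_mult ::
    "'x set \<Rightarrow> ('x \<Rightarrow> 'x \<Rightarrow> complex) \<Rightarrow> ('x \<Rightarrow> 'x \<Rightarrow> complex) \<Rightarrow> 'x \<Rightarrow> 'x \<Rightarrow> complex" where
  "mat_mult X M N = (\<lambda>y z. \<Sum>w\<in>X. M y w * N w z)"

definition diag_mat :: "'x set \<Rightarrow> 'x \<Rightarrow> 'x \<Rightarrow> complex" where
  "diag_mat Y = (\<lambda>y z. of_bool (y = z \<and> y \<in> Y))"

definition adj_mat :: "('x \<times> 'x) set \<Rightarrow> 'x \<Rightarrow> 'x \<Rightarrow> complex" where
  "adj_mat E = (\<lambda>y z. of_bool ((y, z) \<in> E))"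

text \<open>
  Only real eigenvalues are collected, so that they can be ordered; this loses nothing, as
  the adjacency matrix of an undirected graph is real symmetric.
\<close>

definition graph_eigenvalues :: "'x set \<Rightarrow> ('x \<times> 'x) set \<Rightarrow> real set" where
  "graph_eigenvalues X E =
     {\<theta>. \<exists>v \<in> cvecs X. v \<noteq> 0 \<and> mat_vec X (adj_mat E) v = cvec_scale (complex_of_real \<theta>) v}"

definition delsarte_clique :: "'x set \<Rightarrow> ('x \<times> 'x) set \<Rightarrow> 'x set \<Rightarrow> bool" where
  "delsarte_clique X E C \<longleftrightarrow> is_clique X E C \<and>
     real (card C) = 1 - Max (graph_eigenvalues X E) / Min (graph_eigenvalues X E)"

definition clique_layer :: "'x set \<Rightarrow> ('x \<times> 'x) set \<Rightarrow> 'x set \<Rightarrow> nat \<Rightarrow> 'x set" where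
  "clique_layer X E C i = {y \<in> X. gdist_set E y C = i}"

definition cell_minus :: "'x set \<Rightarrow> ('x \<times> 'x) set \<Rightarrow> 'x \<Rightarrow> 'x set \<Rightarrow> nat \<Rightarrow> 'x set" where
  "cell_minus X E x C i = {y \<in> clique_layer X E C i. gdist E x y = i}"

definition cell_plus :: "'x set \<Rightarrow> ('x \<times> 'x) set \<Rightarrow> 'x \<Rightarrow> 'x set \<Rightarrow> nat \<Rightarrow> 'x set" where
  "cell_plus X E x C i = {y \<in> clique_layer X E C i. gdist E x y = i + 1}"

inductive_set generated_algebra ::
    "'x set \<Rightarrow> ('x \<Rightarrow> 'x \<Rightarrow> complex) set \<Rightarrow> ('x \<Rightarrow> 'x \<Rightarrow> complex) set"
  for X :: "'x set" and G :: "('x \<Rightarrow> 'x \<Rightarrow> complex) set" where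
  gen: "M \<in> G \<Longrightarrow> M \<in> generated_algebra X G"
| one: "diag_mat X \<in> generated_algebra X G"
| add: "M \<in> generated_algebra X G \<Longrightarrow> N \<in> generated_algebra X G \<Longrightarrow>
        M + N \<in> generated_algebra X G"
| scale: "M \<in> generated_algebra X G \<Longrightarrow> (\<lambda>y z. c * M y z) \<in> generated_algebra X G"
| mult: "M \<in> generated_algebra X G \<Longrightarrow> N \<in> generated_algebra X G \<Longrightarrow>
        mat_mult X M N \<in> generated_algebra X G"

definition terwilliger_algebra ::
    "'x set \<Rightarrow> ('x \<times> 'x) set \<Rightarrow> nat \<Rightarrow> 'x \<Rightarrow> 'x set \<Rightarrow> ('x \<Rightarrow> 'x \<Rightarrow> complex) set" where
  "terwilliger_algebra X E D x C = generated_algebra X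
     ({adj_mat E} \<union> {diag_mat {y \<in> X. gdist E x y = i} | i. i \<le> D}
                  \<union> {diag_mat (clique_layer X E C i) | i. i < D})"

definition primary_space ::
    "'x set \<Rightarrow> ('x \<times> 'x) set \<Rightarrow> nat \<Rightarrow> 'x \<Rightarrow> 'x set \<Rightarrow> ('x \<Rightarrow> complex) set" where
  "primary_space X E D x C = module.span cvec_scale
     (\<Union>i<D. {char_vec (cell_minus X E x C i), char_vec (cell_plus X E x C i)})"

definition alg_module ::
    "'x set \<Rightarrow> ('x \<Rightarrow> 'x \<Rightarrow> complex) set \<Rightarrow> ('x \<Rightarrow> complex) set \<Rightarrow> bool" where
  "alg_module X T W \<longleftrightarrow> W \<subseteq> cvecs X \<and> module.subspace cvec_scale W \<and>
     (\<forall>M\<in>T. \<forall>v\<in>W. mat_vec X M v \<in> W)"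

definition irreducible_alg_module ::
    "'x set \<Rightarrow> ('x \<Rightarrow> 'x \<Rightarrow> complex) set \<Rightarrow> ('x \<Rightarrow> complex) set \<Rightarrow> bool" where
  "irreducible_alg_module X T W \<longleftrightarrow> alg_module X T W \<and> W \<noteq> {0} \<and>
     (\<forall>U. alg_module X T U \<and> U \<subseteq> W \<longrightarrow> U = {0} \<or> U = W)"

end

theory Submission
  imports Defs
begin

text \<open>
  By counting incidences with \<open>(D - 1)\<close>-dimensional subspaces, \<open>A + [D] I\<close> is positive
  semidefinite and, as \<open>N \<ge> 2 D\<close>, singular. Hence the extreme eigenvalues are
  \<open>[D] ([N - D + 1] - 1)\<close> and \<open>- [D]\<close>, and a Delsarte clique has \<open>[N - D + 1]\<close> elements. A clique
  of this size consists of all vertices containing a fixed \<open>(D - 1)\<close>-dimensional subspace \<open>P\<close> or,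
  when \<open>N = 2 D\<close>, of all vertices inside a fixed \<open>(D + 1)\<close>-dimensional subspace \<open>T\<close>.
  In either case the cells are determined by the dimensions of the intersections of a vertex with
  the two members of a chain, \<open>P \<subseteq> x\<close> or \<open>x \<subseteq> T\<close>, so they are orbits of the stabiliser of that
  chain and form an equitable partition.

  Given this, no intersection numbers are needed for irreducibility: a nonzero submodule of the
  primary space contains, after projecting with the \<open>E\<^sup>*\<close>, the characteristic vector of some cell,
  hence that of every cell adjacent to it, and the graph is connected.
\<close>

section \<open>Equitable layer partitions\<close>

lemma subspace_cvec_iff:
  "module.subspace cvec_scale W \<longleftrightarrow>
     (0 :: 'x \<Rightarrow> complex) \<in> W \<and> (\<forall>u\<in>W. \<forall>v\<in>W. u + v \<in> W) \<and> (\<forall>c. \<forall>v\<in>W. cvec_scale c v \<in> W)"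
proof -
  interpret vector_space "cvec_scale :: complex \<Rightarrow> ('x \<Rightarrow> complex) \<Rightarrow> _"
    by (rule vector_space_cvec_scale)
  show ?thesis
    by (auto simp: subspace_def)
qed

lemma sum_fun_apply: "sum f A y = (\<Sum>k\<in>A. f k y)" for f :: "'k \<Rightarrow> 'x \<Rightarrow> 'b::comm_monoid_add"
  by (induction A rule: infinite_finite_induct) auto

lemma mat_vec_diag_mat:
  assumes "finite X" "Y \<subseteq> X"
  shows "mat_vec X (diag_mat Y) v = (\<lambda>y. if y \<in> Y then v y else 0)"
proof
  fix y
  have "mat_vec X (diag_mat Y) v y = (\<Sum>z\<in>X. if z = y then of_bool (y \<in> Y) * v y else 0)"
    unfolding mat_vec_def diag_mat_def by (intro sum.cong) auto
  also have "\<dots> = (if y \<in> Y then v y else 0)"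
    using assms by (auto simp: sum.delta)
  finally show "mat_vec X (diag_mat Y) v y = (if y \<in> Y then v y else 0)" .
qed

lemma mat_vec_mat_mult:
  assumes "finite X"
  shows "mat_vec X (mat_mult X M N) v = mat_vec X M (mat_vec X N v)"
proof
  fix y
  have "mat_vec X (mat_mult X M N) v y = (\<Sum>z\<in>X. \<Sum>w\<in>X. M y w * N w z * v z)"
    by (simp add: mat_vec_def mat_mult_def sum_distrib_right)
  also have "\<dots> = (\<Sum>w\<in>X. \<Sum>z\<in>X. M y w * N w z * v z)"
    by (rule sum.swap)
  also have "\<dots> = mat_vec X M (mat_vec X N v) y"
    by (simp add: mat_vec_def sum_distrib_left mult.assoc)
  finally show "mat_vec X (mat_mult X M N) v y = mat_vec X M (mat_vec X N v) y" .
qed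

lemma mat_vec_add_left: "mat_vec X (M + N) v = mat_vec X M v + mat_vec X N v"
  by (auto simp: mat_vec_def fun_eq_iff algebra_simps sum.distrib)

lemma mat_vec_scale_left: "mat_vec X (\<lambda>y z. c * M y z) v = cvec_scale c (mat_vec X M v)"
  by (auto simp: mat_vec_def cvec_scale_def fun_eq_iff sum_distrib_left algebra_simps)

text \<open>Invariance under generators passes to sums, multiples and products.
  \<open>W \<subseteq> cvecs X\<close> serves the unit: \<open>diag_mat X\<close> acts as the
  identity only on vectors vanishing outside \<open>X\<close>.\<close>

lemma generated_algebra_invariant:
  assumes "finite X" "module.subspace cvec_scale W" "W \<subseteq> cvecs X"
    and gens: "\<And>M v. M \<in> G \<Longrightarrow> v \<in> W \<Longrightarrow> mat_vec X M v \<in> W"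
  shows "M \<in> generated_algebra X G \<Longrightarrow> v \<in> W \<Longrightarrow> mat_vec X M v \<in> W"
proof (induction arbitrary: v rule: generated_algebra.induct)
  case (one v)
  then have "mat_vec X (diag_mat X) v = v"
    using assms(1,3) by (auto simp: mat_vec_diag_mat cvecs_def fun_eq_iff)
  with one show ?case by simp
qed (use assms in \<open>auto simp: mat_vec_mat_mult mat_vec_add_left mat_vec_scale_left subspace_cvec_iff\<close>)

text \<open>One label replaces the two families of cells: its fibre over \<open>(i, i)\<close> is
  \<open>cell_minus\<close>, over \<open>(i, i + 1)\<close> it is \<open>cell_plus\<close>.\<close>

definition layer_pair :: "('x \<times> 'x) set \<Rightarrow> 'x \<Rightarrow> 'x set \<Rightarrow> 'x \<Rightarrow> nat \<times> nat" where
  "layer_pair E x C y = (gdist_set E y C, gdist E x y)"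

lemma cell_minus_eq: "cell_minus X E x C i = {y \<in> X. layer_pair E x C y = (i, i)}"
  by (auto simp: cell_minus_def clique_layer_def layer_pair_def)

lemma cell_plus_eq: "cell_plus X E x C i = {y \<in> X. layer_pair E x C y = (i, i + 1)}"
  by (auto simp: cell_plus_def clique_layer_def layer_pair_def)

text \<open>Collects what irreducibility uses about the graph. By \<open>layers\<close> every vertex
  lies in some cell; by \<open>equitable\<close> its number of neighbours in each cell depends only
  on its own cell.\<close>

locale equitable_layers =
  fixes X :: "'x set" and E :: "('x \<times> 'x) set" and D :: nat and x :: 'x and C :: "'x set"
  assumes finite_X: "finite X" and X_nonempty: "X \<noteq> {}" and E_sub: "E \<subseteq> X \<times> X"
    and connected: "y \<in> X \<Longrightarrow> z \<in> X \<Longrightarrow> (y, z) \<in> E\<^sup>*"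
    and E_sym: "(y, z) \<in> E \<Longrightarrow> (z, y) \<in> E"
    and layers: "y \<in> X \<Longrightarrow> \<exists>i<D. layer_pair E x C y = (i, i) \<or> layer_pair E x C y = (i, i + 1)"
    and equitable: "y \<in> X \<Longrightarrow> y' \<in> X \<Longrightarrow> layer_pair E x C y = layer_pair E x C y' \<Longrightarrow>
      card {z \<in> X. (y, z) \<in> E \<and> layer_pair E x C z = k}
        = card {z \<in> X. (y', z) \<in> E \<and> layer_pair E x C z = k}"
begin

abbreviation "\<kappa> \<equiv> layer_pair E x C"
abbreviation "cell k \<equiv> {y \<in> X. \<kappa> y = k}"

text \<open>The primary space described by equations instead of generators, so that membership can
  be checked pointwise; \<open>primary_space_eq\<close> identifies the two.\<close>

definition W :: "('x \<Rightarrow> complex) set" where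
  "W = {v \<in> cvecs X. \<forall>y\<in>X. \<forall>y'\<in>X. \<kappa> y = \<kappa> y' \<longrightarrow> v y = v y'}"

lemma W_cvecs: "W \<subseteq> cvecs X"
  by (auto simp: W_def)

lemma W_I:
  assumes "\<And>y. y \<notin> X \<Longrightarrow> v y = 0"
    and "\<And>y y'. y \<in> X \<Longrightarrow> y' \<in> X \<Longrightarrow> \<kappa> y = \<kappa> y' \<Longrightarrow> v y = v y'"
  shows "v \<in> W"
  using assms unfolding W_def cvecs_def by blast

lemma W_eq: "v \<in> W \<Longrightarrow> y \<in> X \<Longrightarrow> y' \<in> X \<Longrightarrow> \<kappa> y = \<kappa> y' \<Longrightarrow> v y = v y'"
  unfolding W_def by blast

lemma W_D: "v \<in> W \<Longrightarrow> z \<in> cell k \<Longrightarrow> z' \<in> cell k \<Longrightarrow> v z = v z'"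
  by (rule W_eq) simp_all

lemma W_0: "v \<in> W \<Longrightarrow> y \<notin> X \<Longrightarrow> v y = 0"
  unfolding W_def cvecs_def by blast

lemma subspace_W: "module.subspace cvec_scale W"
  unfolding subspace_cvec_iff
proof (intro conjI ballI allI)
  show "0 \<in> W" by (rule W_I) auto
next
  fix u v assume "u \<in> W" "v \<in> W"
  then show "u + v \<in> W"
    by (intro W_I) (auto simp: W_0 intro: arg_cong2[of _ _ _ _ "(+)"] W_eq)
next
  fix c v assume "v \<in> W"
  then show "cvec_scale c v \<in> W"
    by (intro W_I) (auto simp: W_0 cvec_scale_def intro: W_eq)
qed

text \<open>The representative picked by \<open>SOME\<close> is immaterial, since \<open>v\<close>
  is constant on each cell.\<close>

lemma W_eq_sum:
  assumes "v \<in> W"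
  shows "v = (\<Sum>k\<in>\<kappa> ` X. cvec_scale (v (SOME y. y \<in> cell k)) (char_vec (cell k)))"
proof
  fix y
  show "v y = (\<Sum>k\<in>\<kappa> ` X. cvec_scale (v (SOME y. y \<in> cell k)) (char_vec (cell k))) y"
  proof (cases "y \<in> X")
    case True
    have "(SOME z. z \<in> cell (\<kappa> y)) \<in> cell (\<kappa> y)"
      by (rule someI[of _ y]) (use True in auto)
    then have v: "v (SOME z. z \<in> cell (\<kappa> y)) = v y"
      using True assms unfolding W_def by blast
    have "(\<Sum>k\<in>\<kappa> ` X. cvec_scale (v (SOME y. y \<in> cell k)) (char_vec (cell k)) y)
        = (\<Sum>k\<in>\<kappa> ` X. if k = \<kappa> y then v y else 0)"
      by (intro sum.cong) (use True v in \<open>auto simp: cvec_scale_def char_vec_def\<close>)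
    also have "\<dots> = v y"
      using True finite_X by simp
    finally show ?thesis by (simp add: sum_fun_apply)
  next
    case False
    then show ?thesis using assms by (auto simp: sum_fun_apply W_0 cvec_scale_def char_vec_def)
  qed
qed

lemma W_sub_subspace:
  assumes "module.subspace cvec_scale U" "\<And>y. y \<in> X \<Longrightarrow> char_vec (cell (\<kappa> y)) \<in> U"
  shows "W \<subseteq> U"
proof
  interpret vs: vector_space "cvec_scale :: complex \<Rightarrow> ('x \<Rightarrow> complex) \<Rightarrow> _"
    by (rule vector_space_cvec_scale)
  fix v assume "v \<in> W"
  then show "v \<in> U"
    by (subst W_eq_sum) (auto intro!: vs.subspace_sum vs.subspace_scale assms)
qed

lemma char_vec_cell_W: "char_vec (cell k) \<in> W"
  by (intro W_I) (auto simp: char_vec_def)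

text \<open>By \<open>layers\<close> each fibre of the label that meets \<open>X\<close> is one of
  the generating cells, so the indicators of these fibres lie in the span; conversely each generator
  is constant on cells.\<close>

lemma primary_space_eq: "primary_space X E D x C = W"
proof -
  interpret vs: vector_space "cvec_scale :: complex \<Rightarrow> ('x \<Rightarrow> complex) \<Rightarrow> _"
    by (rule vector_space_cvec_scale)
  let ?G = "\<Union>i<D. {char_vec (cell_minus X E x C i), char_vec (cell_plus X E x C i)}"
  have "vs.span ?G \<subseteq> W"
    by (intro vs.span_minimal subspace_W)
      (auto simp: cell_minus_eq cell_plus_eq simp del: mem_Collect_eq intro: char_vec_cell_W)
  moreover have "W \<subseteq> vs.span ?G"
  proof (intro W_sub_subspace vs.subspace_span vs.span_base)
    fix y assume "y \<in> X"
    then show "char_vec (cell (\<kappa> y)) \<in> ?G"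
      using layers[of y] unfolding cell_minus_eq cell_plus_eq by fastforce
  qed
  ultimately show ?thesis unfolding primary_space_def by blast
qed

text \<open>Grouping neighbours by cell, \<open>A v\<close> at \<open>y\<close> is the sum over
  cells of the value of \<open>v\<close> there times the number of neighbours of \<open>y\<close> in
  that cell. Equitability makes these numbers depend only on the cell of \<open>y\<close>.\<close>

lemma adj_W:
  assumes "v \<in> W"
  shows "mat_vec X (adj_mat E) v \<in> W"
proof -
  have eq: "mat_vec X (adj_mat E) v y
      = (\<Sum>k\<in>\<kappa> ` X. v (SOME y. y \<in> cell k) * of_nat (card {z \<in> X. (y, z) \<in> E \<and> \<kappa> z = k}))"
    for y
  proof -
    have "mat_vec X (adj_mat E) v y = (\<Sum>k\<in>\<kappa> ` X. \<Sum>z\<in>cell k. of_bool ((y, z) \<in> E) * v z)"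
      unfolding mat_vec_def adj_mat_def using finite_X by (intro sum.image_gen) auto
    also have "\<dots> = (\<Sum>k\<in>\<kappa> ` X. v (SOME y. y \<in> cell k) * of_nat (card {z \<in> X. (y, z) \<in> E \<and> \<kappa> z = k}))"
    proof (rule sum.cong[OF refl])
      fix k assume "k \<in> \<kappa> ` X"
      then obtain w where "w \<in> cell k" by auto
      then have "(SOME y. y \<in> cell k) \<in> cell k" by (rule someI)
      then have "v z = v (SOME y. y \<in> cell k)" if "z \<in> cell k" for z
        using that W_D[OF assms] by blast
      then have "(\<Sum>z\<in>cell k. of_bool ((y, z) \<in> E) * v z)
          = (\<Sum>z\<in>cell k. of_bool ((y, z) \<in> E) * v (SOME y. y \<in> cell k))"
        by (intro sum.cong) auto
      also have "\<dots> = of_nat (card (cell k \<inter> {z. (y, z) \<in> E})) * v (SOME y. y \<in> cell k)"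
        using finite_X by (simp add: sum_distrib_right[symmetric] sum.If_cases of_bool_def)
      also have "cell k \<inter> {z. (y, z) \<in> E} = {z \<in> X. (y, z) \<in> E \<and> \<kappa> z = k}" by auto
      finally show "(\<Sum>z\<in>cell k. of_bool ((y, z) \<in> E) * v z)
          = v (SOME y. y \<in> cell k) * of_nat (card {z \<in> X. (y, z) \<in> E \<and> \<kappa> z = k})"
        by (simp add: mult.commute)
    qed
    finally show ?thesis .
  qed
  have "mat_vec X (adj_mat E) v y = mat_vec X (adj_mat E) v y'"
    if "y \<in> X" "y' \<in> X" "\<kappa> y = \<kappa> y'" for y y'
    unfolding eq using equitable[OF that] by simp
  moreover have "mat_vec X (adj_mat E) v y = 0" if "y \<notin> X" for y
    unfolding mat_vec_def adj_mat_def using that E_sub by (intro sum.neutral) auto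
  ultimately show ?thesis by (intro W_I)
qed

lemma restrict_W: "v \<in> W \<Longrightarrow> (\<lambda>y. if y \<in> X \<and> P (\<kappa> y) then v y else 0) \<in> W"
  by (intro W_I) (auto intro: W_eq)

abbreviation "T \<equiv> terwilliger_algebra X E D x C"

lemma restrict_eq_diag_dist:
  "mat_vec X (diag_mat {y \<in> X. gdist E x y = i}) v = (\<lambda>y. if y \<in> X \<and> snd (\<kappa> y) = i then v y else 0)"
  using finite_X by (auto simp: mat_vec_diag_mat fun_eq_iff layer_pair_def)

lemma restrict_eq_diag_layer:
  "mat_vec X (diag_mat (clique_layer X E C i)) v = (\<lambda>y. if y \<in> X \<and> fst (\<kappa> y) = i then v y else 0)"
  using finite_X by (subst mat_vec_diag_mat) (auto simp: fun_eq_iff layer_pair_def clique_layer_def)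

text \<open>The diagonal generators merely truncate a vector to a union of cells; equitability
  enters only through the adjacency matrix.\<close>

lemma module_W: "alg_module X T W"
proof -
  have "mat_vec X M v \<in> W" if "M \<in> T" "v \<in> W" for M v
    using that(1) unfolding terwilliger_algebra_def
  proof (rule generated_algebra_invariant[OF finite_X subspace_W, rotated 2])
    fix M v assume M: "M \<in> {adj_mat E} \<union> {diag_mat {y \<in> X. gdist E x y = i} | i. i \<le> D}
                  \<union> {diag_mat (clique_layer X E C i) | i. i < D}" and v: "v \<in> W"
    then show "mat_vec X M v \<in> W"
      by (auto simp only: Un_iff mem_Collect_eq singleton_iff restrict_eq_diag_dist
          restrict_eq_diag_layer intro: adj_W restrict_W)
  qed (use that W_cvecs in auto)
  then show ?thesis
    unfolding alg_module_def using subspace_W W_cvecs by blast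
qed

text \<open>A cell is the intersection of a distance sphere around \<open>x\<close> with a layer of
  \<open>C\<close>, so a product of two diagonal generators projects onto it.\<close>

lemma restrict_cell_mem:
  assumes "alg_module X T U" "u \<in> U" "y \<in> X"
  shows "(\<lambda>z. if z \<in> cell (\<kappa> y) then u z else 0) \<in> U"
proof -
  \<comment> \<open>Here \<open>j\<close> is \<open>i\<close> or \<open>i + 1\<close> with
    \<open>i < D\<close>, so both projections are among the generators.\<close>
  obtain i j where ij: "\<kappa> y = (i, j)" "i < D" "j \<le> D"
    using layers[OF assms(3)] by force
  have "diag_mat {y \<in> X. gdist E x y = j} \<in> T" "diag_mat (clique_layer X E C i) \<in> T"
    using ij unfolding terwilliger_algebra_def by (auto intro!: generated_algebra.gen)
  then have "mat_vec X (diag_mat {y \<in> X. gdist E x y = j})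
      (mat_vec X (diag_mat (clique_layer X E C i)) u) \<in> U"
    using assms unfolding alg_module_def by blast
  also have "mat_vec X (diag_mat {y \<in> X. gdist E x y = j})
      (mat_vec X (diag_mat (clique_layer X E C i)) u) = (\<lambda>z. if z \<in> cell (\<kappa> y) then u z else 0)"
    unfolding restrict_eq_diag_dist restrict_eq_diag_layer using ij by (auto simp: fun_eq_iff)
  finally show ?thesis .
qed

text \<open>Restricted to the cell of \<open>y\<close>, \<open>u\<close> is a nonzero constant;
  dividing by it leaves the indicator.\<close>

lemma char_vec_cell_mem:
  assumes "alg_module X T U" "u \<in> U" "u \<in> W" "y \<in> X" "u y \<noteq> 0"
  shows "char_vec (cell (\<kappa> y)) \<in> U"
proof -
  have "cvec_scale (1 / u y) (\<lambda>z. if z \<in> cell (\<kappa> y) then u z else 0) \<in> U"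
    using restrict_cell_mem[OF assms(1,2,4)] assms(1)
    unfolding alg_module_def subspace_cvec_iff by blast
  also have "cvec_scale (1 / u y) (\<lambda>z. if z \<in> cell (\<kappa> y) then u z else 0) = char_vec (cell (\<kappa> y))"
  proof
    fix z
    have "u z = u y" if "z \<in> cell (\<kappa> y)"
      using W_D[OF assms(3) that] assms(4) by simp
    then show "cvec_scale (1 / u y) (\<lambda>z. if z \<in> cell (\<kappa> y) then u z else 0) z
        = char_vec (cell (\<kappa> y)) z"
      using assms(5) by (auto simp: cvec_scale_def char_vec_def)
  qed
  finally show ?thesis .
qed

text \<open>\<open>A\<close> sends the indicator of the cell of \<open>z\<close> to a vector
  counting neighbours in that cell. At \<open>y\<close> the count is positive, as \<open>z\<close>
  is such a neighbour, so the previous projection argument applies at \<open>y\<close>.\<close>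

lemma char_vec_cell_mem_adjacent:
  assumes U: "alg_module X T U" and z: "char_vec (cell (\<kappa> z)) \<in> U" and E: "(z, y) \<in> E"
  shows "char_vec (cell (\<kappa> y)) \<in> U"
proof -
  let ?u = "mat_vec X (adj_mat E) (char_vec (cell (\<kappa> z)))"
  have yz: "y \<in> X" "z \<in> X" using E E_sub by auto
  have "adj_mat E \<in> T"
    unfolding terwilliger_algebra_def by (auto intro!: generated_algebra.gen)
  then have "?u \<in> U" using U z unfolding alg_module_def by blast
  moreover have "?u \<in> W" by (intro adj_W char_vec_cell_W)
  moreover have "?u y \<noteq> 0"
  proof -
    \<comment> \<open>Moving the sum into the naturals excludes cancellation: it vanishes only if
      every term does.\<close>
    have "?u y = (\<Sum>w\<in>X. of_nat (of_bool ((y, w) \<in> E \<and> \<kappa> w = \<kappa> z)))"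
      unfolding mat_vec_def adj_mat_def char_vec_def by (intro sum.cong) auto
    also have "\<dots> = of_nat (\<Sum>w\<in>X. of_bool ((y, w) \<in> E \<and> \<kappa> w = \<kappa> z))"
      by simp
    finally have "?u y = of_nat (\<Sum>w\<in>X. of_bool ((y, w) \<in> E \<and> \<kappa> w = \<kappa> z))" .
    moreover have "\<exists>w\<in>X. (y, w) \<in> E \<and> \<kappa> w = \<kappa> z"
      by (rule bexI[of _ z]) (use E_sym[OF E] yz in auto)
    ultimately show ?thesis
      using finite_X by (simp only: of_nat_eq_0_iff sum_eq_0_iff of_bool_eq_0_iff) blast
  qed
  ultimately show ?thesis using char_vec_cell_mem[OF U] yz by blast
qed

theorem irreducible_primary_space: "irreducible_alg_module X T (primary_space X E D x C)"
  unfolding irreducible_alg_module_def primary_space_eq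
proof (intro conjI allI impI)
  obtain y where y: "y \<in> X" using X_nonempty by auto
  then have "char_vec (cell (\<kappa> y)) y \<noteq> 0" by (simp add: char_vec_def)
  then have "char_vec (cell (\<kappa> y)) \<noteq> 0" by auto
  then show "W \<noteq> {0}" using char_vec_cell_W[of "\<kappa> y"] by auto
next
  fix U assume U: "alg_module X T U \<and> U \<subseteq> W"
  then have sub: "module.subspace cvec_scale U" by (simp add: alg_module_def)
  show "U = {0} \<or> U = W"
  proof (rule disjCI)
    assume "U \<noteq> W"
    show "U = {0}"
    proof (rule ccontr)
      assume "U \<noteq> {0}"
      moreover have "0 \<in> U" using sub by (simp add: subspace_cvec_iff)
      ultimately obtain u where u: "u \<in> U" "u \<noteq> 0" by auto
      then obtain y where y: "u y \<noteq> 0" by (auto simp: fun_eq_iff)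
      have uW: "u \<in> W" using u U by auto
      have yX: "y \<in> X" using y W_0[OF uW] by blast
      have base: "char_vec (cell (\<kappa> y)) \<in> U"
        using char_vec_cell_mem U u uW yX y by blast
      \<comment> \<open>Starting from the cell of \<open>y\<close>, membership spreads along a walk
        to any vertex.\<close>
      have "char_vec (cell (\<kappa> z)) \<in> U" if "z \<in> X" for z
        using connected[OF yX that]
        by (induction rule: rtrancl_induct) (use base U char_vec_cell_mem_adjacent in blast)+
      then have "W \<subseteq> U" by (rule W_sub_subspace[OF sub])
      with \<open>U \<noteq> W\<close> U show False by auto
    qed
  qed
qed (rule module_W)

end

section \<open>Counting subspaces over a finite field\<close>

text \<open>The number \<open>[n] = (q ^ n - 1) / (q - 1)\<close> as a geometric sum, which stays in
  the naturals without division.\<close>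

definition gauss_number :: "nat \<Rightarrow> nat \<Rightarrow> nat" where
  "gauss_number q n = (\<Sum>i<n. q ^ i)"

lemma gauss_number_0 [simp]: "gauss_number q 0 = 0"
  by (simp add: gauss_number_def)

lemma gauss_number_Suc: "gauss_number q (Suc n) = 1 + q * gauss_number q n"
  unfolding gauss_number_def by (simp add: sum.lessThan_Suc_shift sum_distrib_left del: sum.lessThan_Suc)

lemma power_eq_gauss_number: "q > 0 \<Longrightarrow> q ^ n = 1 + (q - 1) * gauss_number q n"
proof (induction n)
  case (Suc n)
  obtain p where "q = Suc p" using Suc.prems gr0_conv_Suc by auto
  with Suc.IH show ?case by (simp add: gauss_number_Suc algebra_simps)
qed simp

lemma gauss_number_pos: "n > 0 \<Longrightarrow> gauss_number q n > 0"
  by (cases n) (auto simp: gauss_number_Suc)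

lemma gauss_number_less:
  assumes "q > 0" "m < n"
  shows "gauss_number q m < gauss_number q n"
  unfolding gauss_number_def using assms by (intro sum_strict_mono2[where b = m]) auto

locale finite_field_space = finite_dimensional_vector_space scale Basis
  for scale :: "'f::{field,finite} \<Rightarrow> 'v::ab_group_add \<Rightarrow> 'v" and Basis :: "'v set" +
  fixes q :: nat
  assumes card_field: "CARD('f) = q"
begin

lemma q_gt_1: "q > 1"
proof -
  have "card {0, 1 :: 'f} \<le> CARD('f)" by (intro card_mono) auto
  then show ?thesis by (simp add: card_field)
qed

lemma span_of_subspace: "subspace S \<Longrightarrow> span S = S"
  by (rule span_eq_iff[THEN iffD2])

text \<open>Each vector of \<open>span (insert b B)\<close> is \<open>scale c b + u\<close> for a
  unique scalar \<open>c\<close> and a unique \<open>u\<close> in \<open>span B\<close>, so every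
  basis vector multiplies the size by \<open>q\<close>.\<close>

lemma card_span_independent:
  assumes "finite B" "independent B"
  shows "finite (span B) \<and> card (span B) = q ^ card B"
  using assms
proof (induction B rule: finite_induct)
  case empty
  then show ?case by simp
next
  case (insert b B)
  then have b: "b \<notin> span B" and B: "independent B" by (auto simp: independent_insert)
  let ?g = "\<lambda>(c, u). scale c b + u"
  have eq: "span (insert b B) = ?g ` (UNIV \<times> span B)"
  proof (intro equalityI subsetI)
    fix v assume "v \<in> span (insert b B)"
    then obtain k where k: "v - scale k b \<in> span B" unfolding span_breakdown_eq by blast
    have "v = ?g (k, v - scale k b)" by simp
    with k show "v \<in> ?g ` (UNIV \<times> span B)" by blast
  next
    fix v assume "v \<in> ?g ` (UNIV \<times> span B)"
    then obtain c u where v: "v = scale c b + u" and "u \<in> span B" by auto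
    then have "v - scale c b \<in> span B" by simp
    then show "v \<in> span (insert b B)" unfolding span_breakdown_eq by blast
  qed
  have inj: "inj_on ?g (UNIV \<times> span B)"
  proof (rule inj_onI, clarify)
    fix c u c' u' assume u: "u \<in> span B" "u' \<in> span B" and e: "scale c b + u = scale c' b + u'"
    have "scale c b = scale c' b + u' - u" using e by (metis add_diff_cancel_right')
    then have "scale (c - c') b = u' - u" unfolding scale_left_diff_distrib by simp
    then have *: "scale (c - c') b \<in> span B" using span_diff[OF u(2,1)] by metis
    \<comment> \<open>Otherwise dividing by \<open>c - c'\<close> would put \<open>b\<close> itself
      into \<open>span B\<close>.\<close>
    have "c = c'"
    proof (rule ccontr)
      assume "c \<noteq> c'"
      then have "inverse (c - c') * (c - c') = 1" by (intro left_inverse) simp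
      then show False
        using span_scale[OF *, of "inverse (c - c')"] b by (simp only: scale_scale scale_one)
    qed
    with e show "c = c' \<and> u = u'" by simp
  qed
  have IH: "finite (span B)" "card (span B) = q ^ card B" using insert.IH[OF B] by auto
  have "card (span (insert b B)) = card ((UNIV :: 'f set) \<times> span B)"
    unfolding eq by (rule card_image[OF inj])
  also have "\<dots> = q ^ card (insert b B)"
    by (simp only: card_cartesian_product IH card_field card_insert_disjoint[OF insert.hyps] power_Suc)
  finally have "card (span (insert b B)) = q ^ card (insert b B)" .
  moreover have "finite (span (insert b B))"
    unfolding eq using IH by (intro finite_imageI finite_cartesian_product) auto
  ultimately show ?case by blast
qed

lemma card_subspace:
  assumes "subspace S"
  shows "card S = q ^ dim S"
proof -
  obtain B where B: "finite B" "independent B" "span B = S" "card B = dim S"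
    using basis_subspace_exists[OF assms] by metis
  show ?thesis using card_span_independent[OF B(1,2)] unfolding B(3,4) by blast
qed

lemma finite_space: "finite (A :: 'v set)"
proof -
  have "finite (UNIV :: 'v set)"
    using card_span_independent[OF finite_Basis independent_Basis] unfolding span_Basis by blast
  then show ?thesis by (rule finite_subset[OF subset_UNIV])
qed

lemma finite_sets: "finite (F :: 'v set set)"
proof -
  have "finite (Pow (UNIV :: 'v set))" by (simp only: finite_Pow_iff finite_space)
  then show ?thesis by (rule finite_subset[rotated]) auto
qed

lemma dim_span_Un:
  assumes "subspace A" "subspace B"
  shows "dim (span (A \<union> B)) + dim (A \<inter> B) = dim A + dim B"
  using dim_sums_Int[OF assms] assms by (simp add: span_Un span_of_subspace)

lemma subspace_eqI:
  assumes "subspace A" "subspace B" "A \<subseteq> B" "dim B \<le> dim A"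
  shows "A = B"
  using subspace_dim_equal assms by blast

lemma dim_strict_mono:
  assumes "subspace A" "subspace B" "A \<subset> B"
  shows "dim A < dim B"
proof (rule ccontr)
  assume "\<not> dim A < dim B"
  then have "A = B" using assms by (intro subspace_eqI) auto
  with assms show False by simp
qed

lemma dim_span_insert_subspace:
  assumes "subspace S" "v \<notin> S"
  shows "dim (span (insert v S)) = Suc (dim S)"
  using assms by (simp add: dim_insert span_of_subspace)

text \<open>The sets \<open>H - G\<close> partition \<open>Y - G\<close>, because a vector
  \<open>v\<close> outside \<open>G\<close> lies in exactly one such \<open>H\<close>, namely
  \<open>span (insert v G)\<close>. Each part has \<open>q ^ Suc d - q ^ d\<close> vectors with
  \<open>d = dim G\<close>.\<close>

lemma card_superspaces:
  assumes "subspace G" "subspace Y" "G \<subseteq> Y"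
  shows "card {H. subspace H \<and> G \<subseteq> H \<and> H \<subseteq> Y \<and> dim H = Suc (dim G)}
           = gauss_number q (dim Y - dim G)" (is "card ?S = _")
proof -
  define d where "d = dim G"
  have dY: "d \<le> dim Y" using assms dim_subset by (simp add: d_def)
  have "Y - G = (\<Union>H\<in>?S. H - G)"
  proof (intro equalityI subsetI)
    fix v assume v: "v \<in> Y - G"
    let ?H = "span (insert v G)"
    have "?H \<subseteq> Y" using v assms by (intro span_minimal) auto
    moreover have "dim ?H = Suc (dim G)"
      using v assms by (intro dim_span_insert_subspace) auto
    moreover have "G \<subseteq> ?H" "v \<in> ?H" using span_superset[of "insert v G"] by auto
    ultimately show "v \<in> (\<Union>H\<in>?S. H - G)" using v by auto
  qed auto
  then have "card (Y - G) = card (\<Union>H\<in>?S. H - G)" by simp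
  also have "\<dots> = (\<Sum>H\<in>?S. card (H - G))"
  proof (rule card_UN_disjoint)
    show "\<forall>H\<in>?S. \<forall>H'\<in>?S. H \<noteq> H' \<longrightarrow> (H - G) \<inter> (H' - G) = {}"
    proof (intro ballI impI equals0I)
      fix H H' v assume H: "H \<in> ?S" "H' \<in> ?S" "H \<noteq> H'" and v: "v \<in> (H - G) \<inter> (H' - G)"
      have d: "dim (span (insert v G)) = Suc (dim G)"
        using v assms by (intro dim_span_insert_subspace) auto
      have "span (insert v G) = K" if "K \<in> {H, H'}" for K
      proof (rule subspace_eqI)
        show "span (insert v G) \<subseteq> K" using that H v by (intro span_minimal) auto
      qed (use that H d in auto)
      then have "span (insert v G) = H" "span (insert v G) = H'" by auto
      with H(3) show False by simp
    qed
  qed (auto simp: finite_space finite_sets)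
  also have "\<dots> = (\<Sum>H\<in>?S. q ^ Suc d - q ^ d)"
    by (intro sum.cong) (auto simp: card_Diff_subset finite_space card_subspace assms d_def)
  also have "\<dots> = card ?S * (q ^ d * (q - 1))"
    by (simp add: algebra_simps diff_mult_distrib2)
  finally have "card ?S * (q ^ d * (q - 1)) = q ^ dim Y - q ^ d"
    using assms by (simp add: card_Diff_subset finite_space card_subspace d_def)
  also have "q ^ dim Y = q ^ d * q ^ (dim Y - d)"
    using dY by (simp flip: power_add)
  also have "q ^ d * q ^ (dim Y - d) - q ^ d = q ^ d * ((q - 1) * gauss_number q (dim Y - d))"
    using q_gt_1 power_eq_gauss_number[of q "dim Y - d"] by (simp add: algebra_simps)
  finally have "(q ^ d * (q - 1)) * card ?S = (q ^ d * (q - 1)) * gauss_number q (dim Y - d)"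
    by (simp add: algebra_simps)
  then show ?thesis using q_gt_1 unfolding d_def by simp
qed

text \<open>With \<open>Suc\<close> instead of \<open>dim Y - 1\<close> the zero space has no
  hyperplanes, in agreement with \<open>gauss_number q 0 = 0\<close>.\<close>

definition hyperplanes :: "'v set \<Rightarrow> 'v set set" where
  "hyperplanes Y = {H. subspace H \<and> H \<subseteq> Y \<and> Suc (dim H) = dim Y}"

text \<open>
  Fixing one hyperplane \<open>H\<^sub>0\<close>, every other one meets \<open>H\<^sub>0\<close> in a hyperplane of \<open>H\<^sub>0\<close>, and each
  hyperplane of \<open>H\<^sub>0\<close> lies in \<open>q\<close> hyperplanes other than \<open>H\<^sub>0\<close>.
\<close>

lemma card_hyperplanes:
  assumes "subspace Y"
  shows "card (hyperplanes Y) = gauss_number q (dim Y)"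
  using assms
proof (induction "dim Y" arbitrary: Y)
  case 0
  then have "hyperplanes Y = {}" by (simp add: hyperplanes_def del: dim_eq_0)
  then show ?case by (simp flip: 0(1) del: dim_eq_0)
next
  case (Suc n)
  obtain H0 where "subspace H0" "H0 \<subseteq> span Y" "dim H0 = n"
    using choose_subspace_of_subspace[of n Y] Suc.hyps(2) by auto
  then have H0: "subspace H0" "H0 \<subseteq> Y" "dim H0 = n"
    using Suc.prems by (auto simp: span_of_subspace)
  define S where "S G = {H. subspace H \<and> G \<subseteq> H \<and> H \<subseteq> Y \<and> dim H = Suc (dim G)}" for G
  have G: "subspace G" "G \<subseteq> H0" "Suc (dim G) = n" if "G \<in> hyperplanes H0" for G
    using that H0 by (auto simp: hyperplanes_def)
  have "hyperplanes Y = insert H0 (\<Union>G\<in>hyperplanes H0. S G - {H0})"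
  proof (intro equalityI subsetI)
    fix H assume "H \<in> hyperplanes Y"
    then have H: "subspace H" "H \<subseteq> Y" "dim H = n"
      using Suc.hyps(2) by (auto simp: hyperplanes_def)
    show "H \<in> insert H0 (\<Union>G\<in>hyperplanes H0. S G - {H0})"
    proof (cases "H = H0")
      case False
      \<comment> \<open>The sum of the distinct hyperplanes \<open>H\<close> and \<open>H0\<close>
        has dimension \<open>n + 1\<close>, so the dimension formula leaves \<open>n - 1\<close> for
        their intersection.\<close>
      have sub: "span (H \<union> H0) \<subseteq> Y" using H H0 Suc.prems by (intro span_minimal) auto
      have "H0 \<subset> span (H \<union> H0)"
        using span_superset[of "H \<union> H0"] False subspace_eqI[of H H0] H H0 by auto
      then have "n < dim (span (H \<union> H0))" using dim_strict_mono H0 subspace_span by metis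
      moreover have "dim (span (H \<union> H0)) \<le> Suc n" using dim_subset[OF sub] Suc.hyps(2) by simp
      ultimately have "Suc (dim (H \<inter> H0)) = n"
        using dim_span_Un[OF H(1) H0(1)] H H0 by simp
      then have "H \<inter> H0 \<in> hyperplanes H0" "H \<in> S (H \<inter> H0)"
        using H H0 by (auto simp: hyperplanes_def S_def subspace_inter)
      with False show ?thesis by auto
    qed simp
  next
    fix H assume "H \<in> insert H0 (\<Union>G\<in>hyperplanes H0. S G - {H0})"
    then consider "H = H0" | G where "G \<in> hyperplanes H0" "H \<in> S G" by blast
    then show "H \<in> hyperplanes Y"
    proof cases
      case 1
      then show ?thesis using H0 Suc.hyps(2) by (simp add: hyperplanes_def)
    next
      case 2
      then have "subspace H" "H \<subseteq> Y" "dim H = n" using G(3)[OF 2(1)] by (simp_all add: S_def)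
      then show ?thesis using Suc.hyps(2) by (simp add: hyperplanes_def)
    qed
  qed
  moreover have "H0 \<notin> (\<Union>G\<in>hyperplanes H0. S G - {H0})" by blast
  ultimately have "card (hyperplanes Y) = Suc (card (\<Union>G\<in>hyperplanes H0. S G - {H0}))"
    by (simp only: card_insert_disjoint[OF finite_sets] simp_thms)
  also have "card (\<Union>G\<in>hyperplanes H0. S G - {H0}) = (\<Sum>G\<in>hyperplanes H0. card (S G - {H0}))"
  proof (intro card_UN_disjoint finite_sets ballI impI equals0I)
    fix G G' H assume GG: "G \<in> hyperplanes H0" "G' \<in> hyperplanes H0" "G \<noteq> G'"
      and H: "H \<in> (S G - {H0}) \<inter> (S G' - {H0})"
    have H': "subspace H" "dim H = n" "H \<noteq> H0" "G \<subseteq> H" "G' \<subseteq> H"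
      using H G(3)[OF GG(1)] by (simp_all add: S_def)
    \<comment> \<open>Once \<open>H \<inter> H0\<close> has dimension below \<open>n\<close>, both
      \<open>G\<close> and \<open>G'\<close>, of dimension \<open>n - 1\<close> inside it, must
      equal it.\<close>
    have "\<not> H0 \<subseteq> H"
    proof
      assume "H0 \<subseteq> H"
      then have "H0 = H" using H0 H' by (intro subspace_eqI) simp_all
      with H'(3) show False by simp
    qed
    then have "H \<inter> H0 \<subset> H0" by blast
    then have "dim (H \<inter> H0) < n"
      using dim_strict_mono[OF subspace_inter[OF H'(1) H0(1)] H0(1)] H0(3) by simp
    then have "K = H \<inter> H0" if "K \<in> {G, G'}" for K
      using that H' G[OF GG(1)] G[OF GG(2)] H0 by (intro subspace_eqI subspace_inter) auto
    with GG(3) show False by auto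
  qed
  also have "\<dots> = (\<Sum>G\<in>hyperplanes H0. q)"
  proof (rule sum.cong[OF refl])
    fix G assume "G \<in> hyperplanes H0"
    note G = G[OF this]
    \<comment> \<open>\<open>G\<close> has codimension two in \<open>Y\<close>, hence
      \<open>[2] = q + 1\<close> intermediate subspaces, one of which is \<open>H0\<close>.\<close>
    have "dim Y - dim G = Suc (Suc 0)" using G(3) Suc.hyps(2) by linarith
    then have "card (S G) = gauss_number q (Suc (Suc 0))"
      using card_superspaces[of G Y] G H0 Suc.prems unfolding S_def by simp
    moreover have "H0 \<in> S G" using G H0 by (auto simp: S_def)
    ultimately show "card (S G - {H0}) = q"
      by (simp add: finite_sets gauss_number_Suc)
  qed
  also have "\<dots> = q * gauss_number q n"
    using Suc.hyps(1)[of H0] H0 by simp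
  finally show ?case using Suc.hyps(2)[symmetric] by (simp add: gauss_number_Suc)
qed

end

section \<open>Automorphisms fixing a chain of subspaces\<close>

text \<open>Bijections chosen separately on each label class are glued together.\<close>

lemma bij_betw_preserving_labels:
  assumes "finite B" "finite B'"
    and card: "\<And>t. card {b \<in> B. l b = t} = card {b \<in> B'. l' b = t}"
  obtains f where "bij_betw f B B'" "\<And>b. b \<in> B \<Longrightarrow> l' (f b) = l b"
proof -
  have "\<exists>g. bij_betw g {b \<in> B. l b = t} {b \<in> B'. l' b = t}" for t
    using assms by (intro finite_same_card_bij) auto
  then obtain g where g: "\<And>t. bij_betw (g t) {b \<in> B. l b = t} {b \<in> B'. l' b = t}" by metis
  have mem: "g (l b) b \<in> B'" "l' (g (l b) b) = l b" if "b \<in> B" for b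
    using bij_betw_apply[OF g, of b "l b"] that by auto
  show ?thesis
  proof (rule that)
    show "bij_betw (\<lambda>b. g (l b) b) B B'"
      unfolding bij_betw_def
    proof (intro conjI equalityI subsetI)
      show "inj_on (\<lambda>b. g (l b) b) B"
      proof (rule inj_onI)
        fix b c assume bc: "b \<in> B" "c \<in> B" "g (l b) b = g (l c) c"
        then have "l b = l c" using mem(2) by metis
        with bc g[of "l b"] show "b = c" unfolding bij_betw_def inj_on_def by auto
      qed
    next
      fix b assume "b \<in> B'"
      then obtain c where "c \<in> B" "l c = l' b" "b = g (l' b) c"
        using g[of "l' b"] unfolding bij_betw_def by blast
      then have "c \<in> B" "b = g (l c) c" by simp_all
      then show "b \<in> (\<lambda>b. g (l b) b) ` B" by blast
    qed (use mem in auto)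
  qed (use mem in auto)
qed

context finite_field_space
begin

lemma basis_extension:
  assumes "independent B" "B \<subseteq> S" "subspace S"
  obtains B' where "B \<subseteq> B'" "independent B'" "span B' = S"
proof -
  obtain B' where "B \<subseteq> B'" "B' \<subseteq> S" "independent B'" "S \<subseteq> span B'"
    using maximal_independent_subset_extend[OF assms(2,1)] by blast
  moreover have "span B' = S"
    using calculation assms(3) by (intro span_subspace)
  ultimately show ?thesis using that by blast
qed

lemma card_basis: "independent B \<Longrightarrow> span B = S \<Longrightarrow> card B = dim S"
  by (drule dim_span_eq_card_independent) (simp only:)

text \<open>The dimension formula gives
  \<open>card K + card M - dim (span K \<inter> span M)\<close> for the dimension of the joint span.
  The hypothesis bounds the subtracted term by \<open>card (K \<inter> M)\<close>, so the joint span
  has dimension at least \<open>card (K \<union> M)\<close>.\<close>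

lemma independent_Un:
  assumes "independent K" "independent M" "span K \<inter> span M \<subseteq> span (K \<inter> M)"
  shows "independent (K \<union> M)"
proof (rule card_le_dim_spanning[OF span_superset order_refl])
  show "finite (K \<union> M)" by (rule finite_space)
  have "span (span K \<union> span M) = span (K \<union> M)"
    by (rule span_eq[THEN iffD2]) (auto intro: span_base span_mono[THEN subsetD, rotated])
  then have "dim (span (K \<union> M)) + dim (span K \<inter> span M) = card K + card M"
    using dim_span_Un[of "span K" "span M"] assms(1,2)
    by (simp add: dim_eq_card_independent)
  moreover have "dim (span K \<inter> span M) \<le> card (K \<inter> M)"
    using assms(3) finite_space by (rule dim_le_card)
  moreover have "card K + card M = card (K \<union> M) + card (K \<inter> M)"
    by (rule card_Un_Int) (rule finite_space)+
  ultimately show "card (K \<union> M) \<le> dim (span (K \<union> M))" by linarith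
qed

text \<open>Bases are extended upwards: \<open>J\<close> of \<open>y \<inter> P\<close> to
  \<open>K\<close> of \<open>y \<inter> Q\<close> and to \<open>KP\<close> of \<open>P\<close>, then
  \<open>K \<union> KP\<close> to \<open>KQ\<close> of \<open>Q\<close>, then
  \<open>Ky \<union> KQ\<close> to a basis of the whole space.\<close>

lemma adapted_basis:
  assumes "subspace P" "subspace Q" "subspace y" "P \<subseteq> Q"
  obtains B KP KQ Ky where "independent B" "span B = UNIV" "KP \<subseteq> KQ" "KQ \<subseteq> B" "Ky \<subseteq> B"
    "span KP = P" "span KQ = Q" "span Ky = y"
    "card (Ky \<inter> KP) = dim (y \<inter> P)" "card (Ky \<inter> KQ) = dim (y \<inter> Q)"
proof -
  have sub: "subspace (y \<inter> P)" "subspace (y \<inter> Q)" using assms subspace_inter by auto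
  obtain J where J: "independent J" "span J = y \<inter> P"
    using basis_extension[OF independent_empty empty_subsetI sub(1)] by blast
  obtain K where K: "J \<subseteq> K" "independent K" "span K = y \<inter> Q"
    using basis_extension[OF J(1) _ sub(2)] span_superset[of J] J(2) assms(4) by blast
  obtain Ky where Ky: "K \<subseteq> Ky" "independent Ky" "span Ky = y"
    using basis_extension[OF K(2) _ assms(3)] span_superset[of K] K(3) by blast
  obtain KP where KP: "J \<subseteq> KP" "independent KP" "span KP = P"
    using basis_extension[OF J(1) _ assms(1)] span_superset[of J] J(2) by blast
  \<comment> \<open>Both spans meet inside \<open>y \<inter> P\<close>, which is already spanned by
    the shared vectors \<open>J\<close>; this is what \<open>independent_Un\<close> asks
    for.\<close>
  have "span K \<inter> span KP \<subseteq> span J" using K(3) KP(3) J(2) by blast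
  also have "\<dots> \<subseteq> span (K \<inter> KP)" using K(1) KP(1) by (intro span_mono) blast
  finally have "independent (K \<union> KP)" by (intro independent_Un K KP)
  moreover have "K \<union> KP \<subseteq> Q"
    using span_superset[of K] span_superset[of KP] K(3) KP(3) assms(4) by blast
  ultimately obtain KQ where KQ: "K \<union> KP \<subseteq> KQ" "independent KQ" "span KQ = Q"
    using basis_extension assms(2) by metis
  have "span Ky \<inter> span KQ \<subseteq> span K" using Ky(3) KQ(3) K(3) by blast
  also have "\<dots> \<subseteq> span (Ky \<inter> KQ)" using Ky(1) KQ(1) by (intro span_mono) blast
  finally have "independent (Ky \<union> KQ)" by (intro independent_Un Ky KQ)
  then obtain B where B: "Ky \<union> KQ \<subseteq> B" "independent B" "span B = UNIV"
    using basis_extension[OF _ subset_UNIV subspace_UNIV] by metis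
  \<comment> \<open>\<open>Ky \<inter> L\<close> is independent in \<open>y \<inter> span L\<close>,
    and it spans it because it contains \<open>I\<close>.\<close>
  have eq: "card (Ky \<inter> L) = dim (y \<inter> span L)"
    if L: "independent L" "L \<subseteq> B" "I \<subseteq> Ky" "I \<subseteq> L" "y \<inter> span L = span I" for L I
  proof (rule antisym)
    show "card (Ky \<inter> L) \<le> dim (y \<inter> span L)"
      using span_superset[of Ky] span_superset[of L] Ky(3)
      by (intro independent_card_le_dim independent_mono[OF L(1)]) auto
    have "y \<inter> span L \<subseteq> span (Ky \<inter> L)" unfolding L(5) using L by (intro span_mono) auto
    then show "dim (y \<inter> span L) \<le> card (Ky \<inter> L)" using finite_space by (rule dim_le_card)
  qed
  show ?thesis
  proof (rule that[of B KP KQ Ky])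
    show "card (Ky \<inter> KP) = dim (y \<inter> P)"
      using eq[of KP J] KP KQ(1) B(1) Ky(1) K(1) J(2) by auto
    show "card (Ky \<inter> KQ) = dim (y \<inter> Q)"
      using eq[of KQ K] KQ B(1) Ky(1) K(3) by auto
  qed (use B KQ(1,3) KP(3) Ky(3) in auto)
qed

text \<open>
  This makes the cells equitable: they are the orbits on vertices of the stabiliser of a
  chain \<open>P \<subseteq> Q\<close>.
\<close>

lemma automorphism_fixing_chain:
  assumes "subspace P" "subspace Q" "P \<subseteq> Q" "subspace y" "subspace y'"
    and "dim y = dim y'" "dim (y \<inter> P) = dim (y' \<inter> P)" "dim (y \<inter> Q) = dim (y' \<inter> Q)"
  obtains g where "Vector_Spaces.linear scale scale g" "bij g" "g ` P = P" "g ` Q = Q" "g ` y = y'"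
proof -
  obtain B KP KQ Ky where B: "independent B" "span B = UNIV" "KP \<subseteq> KQ" "KQ \<subseteq> B" "Ky \<subseteq> B"
    "span KP = P" "span KQ = Q" "span Ky = y"
    "card (Ky \<inter> KP) = dim (y \<inter> P)" "card (Ky \<inter> KQ) = dim (y \<inter> Q)"
    using adapted_basis[OF assms(1,2,4,3)] by blast
  obtain B' KP' KQ' Ky' where B': "independent B'" "span B' = UNIV" "KP' \<subseteq> KQ'" "KQ' \<subseteq> B'"
    "Ky' \<subseteq> B'" "span KP' = P" "span KQ' = Q" "span Ky' = y'"
    "card (Ky' \<inter> KP') = dim (y' \<inter> P)" "card (Ky' \<inter> KQ') = dim (y' \<inter> Q)"
    using adapted_basis[OF assms(1,2,5,3)] by blast
  note ind = independent_mono[OF B(1)] independent_mono[OF B'(1)]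
  have cards: "card B = card B'" "card KP = card KP'" "card KQ = card KQ'" "card Ky = card Ky'"
    "card (Ky \<inter> KP) = card (Ky' \<inter> KP')" "card (Ky \<inter> KQ) = card (Ky' \<inter> KQ')"
    using card_basis ind B B' assms(6-8) by (metis subset_trans)+
  \<comment> \<open>A bijection of the adapted bases preserving these labels carries all three
    sub-bases along at once. It exists because the sizes of the label classes are functions of the
    six numbers in \<open>cards\<close>.\<close>
  define l where "l b = (b \<in> KP, b \<in> KQ, b \<in> Ky)" for b
  define l' where "l' b = (b \<in> KP', b \<in> KQ', b \<in> Ky')" for b
  have "card {b \<in> B. l b = t} = card {b \<in> B'. l' b = t}" for t
  proof -
    \<comment> \<open>The class \<open>(True, False, _)\<close> is empty as
      \<open>LP \<subseteq> LQ\<close>. In the others each removed set is contained in the set it is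
      removed from, so no subtraction is truncated.\<close>
    have pieces: "card {b \<in> C. (b \<in> LP, b \<in> LQ, b \<in> Ly) = t} =
        (case t of
          (True, True, True) \<Rightarrow> card (Ly \<inter> LP)
        | (True, True, False) \<Rightarrow> card LP - card (Ly \<inter> LP)
        | (True, False, _) \<Rightarrow> 0
        | (False, True, True) \<Rightarrow> card (Ly \<inter> LQ) - card (Ly \<inter> LP)
        | (False, True, False) \<Rightarrow> card LQ - (card LP + (card (Ly \<inter> LQ) - card (Ly \<inter> LP)))
        | (False, False, True) \<Rightarrow> card Ly - card (Ly \<inter> LQ)
        | (False, False, False) \<Rightarrow> card C - (card LQ + (card Ly - card (Ly \<inter> LQ))))"
      (is "card (?S t) = _") if L: "LP \<subseteq> LQ" "LQ \<subseteq> C" "Ly \<subseteq> C" for C LP LQ Ly :: "'v set"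
    proof -
      have D: "card (X - Y) = card X - card Y" if "Y \<subseteq> X" for X Y :: "'v set"
        using finite_space that by (rule card_Diff_subset)
      have U: "card (X \<union> Y) = card X + card Y" if "X \<inter> Y = {}" for X Y :: "'v set"
        using finite_space finite_space that by (rule card_Un_disjoint)
      have e: "?S (True, True, True) = Ly \<inter> LP" "?S (True, True, False) = LP - Ly \<inter> LP"
        "?S (True, False, d) = {}" "?S (False, True, True) = Ly \<inter> LQ - Ly \<inter> LP"
        "?S (False, True, False) = LQ - (LP \<union> (Ly \<inter> LQ - Ly \<inter> LP))"
        "?S (False, False, True) = Ly - Ly \<inter> LQ"
        "?S (False, False, False) = C - (LQ \<union> (Ly - Ly \<inter> LQ))" for d
        using L by auto
      have c: "card (Ly \<inter> LQ - Ly \<inter> LP) = card (Ly \<inter> LQ) - card (Ly \<inter> LP)"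
        "card (Ly - Ly \<inter> LQ) = card Ly - card (Ly \<inter> LQ)"
        "card (LP - Ly \<inter> LP) = card LP - card (Ly \<inter> LP)"
        "card (LP \<union> (Ly \<inter> LQ - Ly \<inter> LP)) = card LP + card (Ly \<inter> LQ - Ly \<inter> LP)"
        "card (LQ \<union> (Ly - Ly \<inter> LQ)) = card LQ + card (Ly - Ly \<inter> LQ)"
        using L by (intro D U; blast)+
      have "card (LQ - (LP \<union> (Ly \<inter> LQ - Ly \<inter> LP))) = card LQ - card (LP \<union> (Ly \<inter> LQ - Ly \<inter> LP))"
        "card (C - (LQ \<union> (Ly - Ly \<inter> LQ))) = card C - card (LQ \<union> (Ly - Ly \<inter> LQ))"
        using L by (intro D; blast)+
      note f = this[unfolded c]
      obtain a b d where t: "t = (a, b, d)" by (cases t)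
      show ?thesis
        unfolding t by (cases a; cases b; cases d) (simp_all only: e c f card.empty prod.case bool.case)
    qed
    show ?thesis
      unfolding l_def l'_def pieces[OF B(3-5)] pieces[OF B'(3-5)] cards ..
  qed
  from bij_betw_preserving_labels[OF finite_space finite_space this]
  obtain f where f: "bij_betw f B B'" "\<And>b. b \<in> B \<Longrightarrow> l' (f b) = l b"
    by blast
  have im: "f ` KP = KP'" "f ` KQ = KQ'" "f ` Ky = Ky'"
  proof -
    have im: "f ` L = L'" if L: "L \<subseteq> B" "L' \<subseteq> B'" "\<And>b. b \<in> B \<Longrightarrow> f b \<in> L' \<longleftrightarrow> b \<in> L" for L L'
    proof (intro equalityI subsetI)
      fix c assume c: "c \<in> L'"
      then obtain b where "b \<in> B" "c = f b" using L(2) f(1) unfolding bij_betw_def by blast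
      with c L(3) show "c \<in> f ` L" by blast
    qed (use L in blast)
    show "f ` KP = KP'" "f ` KQ = KQ'" "f ` Ky = Ky'"
      using B B' f(2) unfolding l_def l'_def by (intro im; auto)+
  qed
  interpret vector_space_pair scale scale ..
  obtain g where g: "Vector_Spaces.linear scale scale g" "\<And>b. b \<in> B \<Longrightarrow> g b = f b"
    using linear_independent_extend[OF B(1)] by blast
  interpret g: Vector_Spaces.linear scale scale g by (rule g(1))
  have span_g: "g ` span L = span (f ` L)" if "L \<subseteq> B" for L
  proof -
    have "g ` L = f ` L" using g(2) that by (intro image_cong) auto
    then show ?thesis using g.span_image[of L] by simp
  qed
  \<comment> \<open>\<open>g\<close> takes one basis onto another, hence is onto, and on a finite
    space this makes it bijective.\<close>
  have "g ` UNIV = UNIV"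
    using span_g[OF order_refl] B(2) B'(2) bij_betw_imp_surj_on[OF f(1)] by metis
  then have "bij g"
    using finite_UNIV_surj_inj[OF finite_space] by (simp add: bij_def)
  moreover have "g ` P = P" "g ` Q = Q" "g ` y = y'"
    using span_g[of KP] span_g[of KQ] span_g[of Ky] im B B' by auto
  ultimately show ?thesis using that g(1) by blast
qed

end

section \<open>Distances and cells in the Grassmann graph\<close>

context finite_field_space
begin

lemma exists_subspace_between:
  assumes "subspace A" "subspace B" "A \<subseteq> B" "dim A \<le> n" "n \<le> dim B"
  obtains H where "subspace H" "A \<subseteq> H" "H \<subseteq> B" "dim H = n"
proof -
  have "\<exists>H. subspace H \<and> A \<subseteq> H \<and> H \<subseteq> B \<and> dim H = n"
    using assms(4,5)
  proof (induction rule: dec_induct)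
    case base
    then show ?case using assms by blast
  next
    case (step n)
    then obtain H where H: "subspace H" "A \<subseteq> H" "H \<subseteq> B" "dim H = n" by auto
    then have "\<not> B \<subseteq> H" using step.prems dim_subset[of B H] by auto
    then obtain v where v: "v \<in> B" "v \<notin> H" by auto
    have "span (insert v H) \<subseteq> B" using H v assms(2) by (intro span_minimal) auto
    moreover have "A \<subseteq> span (insert v H)" using H(2) span_superset[of "insert v H"] by auto
    ultimately show ?case
      using dim_span_insert_subspace[OF H(1) v(2)] H(4) subspace_span by metis
  qed
  then show ?thesis using that by blast
qed

lemma dim_Int_le:
  assumes "subspace A" "subspace B" "subspace Z" "A \<subseteq> Z" "B \<subseteq> Z"
  shows "dim A + dim B \<le> dim Z + dim (A \<inter> B)"
proof -
  have "span (A \<union> B) \<subseteq> Z" using assms by (intro span_minimal) auto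
  then have "dim (span (A \<union> B)) \<le> dim Z" by (rule dim_subset)
  then show ?thesis using dim_span_Un[OF assms(1,2)] by linarith
qed

lemma dim_image_automorphism:
  assumes "Vector_Spaces.linear scale scale g" "bij g" "subspace S"
  shows "subspace (g ` S)" "dim (g ` S) = dim S"
proof -
  interpret g: Vector_Spaces.linear scale scale g by (rule assms(1))
  show s: "subspace (g ` S)" using assms(3) by (rule g.subspace_image)
  \<comment> \<open>Over a finite field a dimension can be read off from the number of
    vectors.\<close>
  have "card (g ` S) = card S"
    using assms(2) by (intro card_image) (auto simp: bij_def intro: inj_on_subset)
  then have "q ^ dim (g ` S) = q ^ dim S" using card_subspace[OF s] card_subspace[OF assms(3)] by metis
  then show "dim (g ` S) = dim S" using q_gt_1 by (rule power_inject_exp[THEN iffD1, rotated])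
qed

end

text \<open>\<open>D_pos\<close> makes the \<open>D - 1\<close> in the adjacency relation a genuine
  subtraction.\<close>

locale grassmann_graph = finite_field_space scale Basis q
  for scale :: "'f::{field,finite} \<Rightarrow> 'v::ab_group_add \<Rightarrow> 'v" and Basis :: "'v set" and q :: nat +
  fixes D :: nat
  assumes D_pos: "D > 0"
begin

abbreviation "X \<equiv> grassmann_verts scale D"
abbreviation "E \<equiv> grassmann_edges scale D"

lemma verts_iff: "y \<in> X \<longleftrightarrow> subspace y \<and> dim y = D"
  by (simp add: grassmann_verts_def)

lemma vertsD: "y \<in> X \<Longrightarrow> subspace y" "y \<in> X \<Longrightarrow> dim y = D"
  by (simp_all add: grassmann_verts_def)

lemma edges_iff: "(y, z) \<in> E \<longleftrightarrow> y \<in> X \<and> z \<in> X \<and> dim (y \<inter> z) = D - 1"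
  by (simp add: grassmann_edges_def)

lemma edges_sym: "(y, z) \<in> E \<Longrightarrow> (z, y) \<in> E"
  by (simp add: edges_iff Int_commute)

text \<open>\<open>w \<inter> z\<close> is a hyperplane of \<open>w\<close>, so cutting
  \<open>y \<inter> w\<close> with it loses at most one dimension.\<close>

lemma dim_Int_edge:
  assumes "(w, z) \<in> E" "subspace y"
  shows "dim (y \<inter> w) \<le> Suc (dim (y \<inter> z))"
proof -
  have wz: "w \<in> X" "z \<in> X" "dim (w \<inter> z) = D - 1" using assms(1) by (auto simp: edges_iff)
  have "dim (y \<inter> w) + dim (w \<inter> z) \<le> dim w + dim ((y \<inter> w) \<inter> (w \<inter> z))"
    using wz assms(2) by (intro dim_Int_le subspace_inter) (auto simp: vertsD)
  moreover have "dim ((y \<inter> w) \<inter> (w \<inter> z)) \<le> dim (y \<inter> z)" by (rule dim_subset) auto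
  ultimately show ?thesis using wz D_pos vertsD(2)[of w] by linarith
qed

lemma walk_imp_dim:
  "(y, z) \<in> E ^^ n \<Longrightarrow> y \<in> X \<Longrightarrow> D \<le> dim (y \<inter> z) + n"
proof (induction n arbitrary: z)
  case (Suc n)
  then obtain w where w: "(y, w) \<in> E ^^ n" "(w, z) \<in> E" by auto
  then have "D \<le> dim (y \<inter> w) + n" using Suc by blast
  also have "dim (y \<inter> w) \<le> Suc (dim (y \<inter> z))"
    using dim_Int_edge[OF w(2)] Suc.prems vertsD by blast
  finally show ?case by simp
qed (simp add: vertsD)

text \<open>\<open>w\<close> arises from \<open>z\<close> by keeping a hyperplane \<open>H\<close>
  that contains \<open>y \<inter> z\<close> and adjoining a vector \<open>u\<close> of
  \<open>y\<close> outside \<open>z\<close>.\<close>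

lemma exists_neighbour_closer:
  assumes "y \<in> X" "z \<in> X" "dim (y \<inter> z) < D"
  obtains w where "(w, z) \<in> E" "dim (y \<inter> w) = Suc (dim (y \<inter> z))"
proof -
  have sub: "subspace y" "subspace z" "subspace (y \<inter> z)" "dim y = D" "dim z = D"
    using assms vertsD subspace_inter by auto
  have "\<not> y \<subseteq> z"
    using assms(3) sub by (metis inf.absorb1 nat_neq_iff)
  then obtain u where u: "u \<in> y" "u \<notin> z" by auto
  have "y \<inter> z \<subseteq> z" "dim (y \<inter> z) \<le> D - 1" "D - 1 \<le> dim z"
    using assms(3) sub(5) by auto
  from exists_subspace_between[OF sub(3,2) this]
  obtain H where H: "subspace H" "y \<inter> z \<subseteq> H" "H \<subseteq> z" "dim H = D - 1"
    by blast
  let ?w = "span (insert u H)"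
  have uH: "u \<notin> H" using u H by auto
  have w: "?w \<in> X" using dim_span_insert_subspace[OF H(1) uH] H(4) D_pos by (simp add: verts_iff)
  \<comment> \<open>Dimension \<open>D\<close> would force \<open>?w = z\<close>, although
    \<open>u\<close> lies in \<open>?w\<close> only.\<close>
  have "dim (?w \<inter> z) \<noteq> D"
  proof
    assume "dim (?w \<inter> z) = D"
    then have "?w \<inter> z = z"
      using sub by (intro subspace_eqI subspace_inter subspace_span) auto
    moreover have "?w \<inter> z = ?w"
      using sub \<open>dim (?w \<inter> z) = D\<close> vertsD[OF w] by (intro subspace_eqI subspace_inter subspace_span) auto
    ultimately show False using u span_base[of u "insert u H"] by auto
  qed
  moreover have "dim (?w \<inter> z) \<le> D" using dim_subset[of "?w \<inter> z" z] sub by simp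
  moreover have "H \<subseteq> ?w \<inter> z" using H(3) span_superset[of "insert u H"] by auto
  then have "D - 1 \<le> dim (?w \<inter> z)" using dim_subset H(4) by metis
  ultimately have wz: "(?w, z) \<in> E" using w assms(2) by (auto simp: edges_iff)
  have "u \<notin> y \<inter> z" using u by simp
  moreover have "span (insert u (y \<inter> z)) \<subseteq> y \<inter> ?w"
    using u(1) H(2) sub(1) span_superset[of "insert u H"]
    by (intro span_minimal subspace_inter subspace_span) auto
  ultimately have "Suc (dim (y \<inter> z)) \<le> dim (y \<inter> ?w)"
    using dim_subset dim_span_insert_subspace[OF sub(3)] by metis
  with dim_Int_edge[OF wz sub(1)] show ?thesis using wz that by (metis le_antisym)
qed

lemma walk_exists:
  "y \<in> X \<Longrightarrow> z \<in> X \<Longrightarrow> dim (y \<inter> z) + n = D \<Longrightarrow> (y, z) \<in> E ^^ n"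
proof (induction n arbitrary: z)
  case 0
  then have "y \<inter> z = y" "y \<inter> z = z"
    by (intro subspace_eqI subspace_inter; auto simp: vertsD)+
  then show ?case by simp
next
  case (Suc n)
  then obtain w where w: "(w, z) \<in> E" "dim (y \<inter> w) = Suc (dim (y \<inter> z))"
    using exists_neighbour_closer[of y z] by auto
  then have "(y, w) \<in> E ^^ n" using Suc by (intro Suc.IH) (auto simp: edges_iff)
  then show ?case using w(1) by auto
qed

lemma dim_Int_verts_le: "z \<in> X \<Longrightarrow> dim (y \<inter> z) \<le> D"
  using dim_subset[of "y \<inter> z" z] vertsD(2)[of z] by simp

text \<open>Each edge changes the intersection with \<open>y\<close> by at most one dimension, which
  bounds the distance below; repeatedly moving to a closer neighbour attains the bound.\<close>

lemma gdist_eq: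
  assumes "y \<in> X" "z \<in> X"
  shows "gdist E y z = D - dim (y \<inter> z)"
  unfolding gdist_def
proof (rule Least_equality)
  show "(y, z) \<in> E ^^ (D - dim (y \<inter> z))"
    using assms dim_Int_verts_le[of z y] by (intro walk_exists) auto
  show "D - dim (y \<inter> z) \<le> n" if "(y, z) \<in> E ^^ n" for n
    using walk_imp_dim[OF that assms(1)] by simp
qed

lemma verts_connected: "y \<in> X \<Longrightarrow> z \<in> X \<Longrightarrow> (y, z) \<in> E\<^sup>*"
  using walk_exists[of y z "D - dim (y \<inter> z)"] dim_Int_verts_le[of z y] relpow_imp_rtrancl by auto

text \<open>An automorphism fixing \<open>P\<close> and \<open>Q\<close> and taking \<open>y\<close>
  to \<open>y'\<close> maps the neighbours of \<open>y\<close> in a cell injectively to those of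
  \<open>y'\<close> in the same cell; exchanging \<open>y\<close> and \<open>y'\<close> gives
  equality.\<close>

lemma card_neighbours_in_cell:
  assumes PQ: "subspace P" "subspace Q" "P \<subseteq> Q"
    and \<kappa>: "\<And>y z. y \<in> X \<Longrightarrow> z \<in> X \<Longrightarrow> 
      \<kappa> y = \<kappa> z \<longleftrightarrow> dim (y \<inter> P) = dim (z \<inter> P) \<and> dim (y \<inter> Q) = dim (z \<inter> Q)"
    and y: "y \<in> X" "y' \<in> X" "\<kappa> y = \<kappa> y'"
  shows "card {z \<in> X. (y, z) \<in> E \<and> \<kappa> z = k} = card {z \<in> X. (y', z) \<in> E \<and> \<kappa> z = k}"
proof -
  have le: "card {z \<in> X. (y, z) \<in> E \<and> \<kappa> z = k} \<le> card {z \<in> X. (y', z) \<in> E \<and> \<kappa> z = k}"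
    if y: "y \<in> X" "y' \<in> X" "\<kappa> y = \<kappa> y'" for y y'
  proof -
    have "dim y = dim y'" "dim (y \<inter> P) = dim (y' \<inter> P)" "dim (y \<inter> Q) = dim (y' \<inter> Q)"
      using y \<kappa>[OF y(1,2)] by (auto simp: vertsD)
    then obtain g where g: "Vector_Spaces.linear scale scale g" "bij g" "g ` P = P" "g ` Q = Q" "g ` y = y'"
      using automorphism_fixing_chain[OF PQ] y vertsD by metis
    have g_Int: "g ` (A \<inter> B) = g ` A \<inter> g ` B" for A B
      using g(2) by (intro image_Int) (simp add: bij_def)
    have g_dim: "subspace (g ` S)" "dim (g ` S) = dim S" if "subspace S" for S
      using dim_image_automorphism[OF g(1,2) that] by auto
    have gX: "g ` z \<in> X" if "z \<in> X" for z
      using that g_dim by (simp add: verts_iff)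
    have "(y', g ` z) \<in> E \<and> \<kappa> (g ` z) = k" if z: "z \<in> X" "(y, z) \<in> E" "\<kappa> z = k" for z
    proof
      have "dim (g ` (y \<inter> z)) = dim (y \<inter> z)"
        using y z by (intro g_dim subspace_inter) (auto simp: vertsD)
      then show "(y', g ` z) \<in> E"
        using z gX y by (simp add: edges_iff g_Int g(5))
      have "dim (g ` (z \<inter> P)) = dim (z \<inter> P)" "dim (g ` (z \<inter> Q)) = dim (z \<inter> Q)"
        using z PQ by (auto intro!: g_dim subspace_inter simp: vertsD)
      then have "dim (g ` z \<inter> P) = dim (z \<inter> P)" "dim (g ` z \<inter> Q) = dim (z \<inter> Q)"
        by (simp_all only: g_Int g(3,4))
      then show "\<kappa> (g ` z) = k"
        using \<kappa>[OF gX z(1)] z(1,3) by blast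
    qed
    then show ?thesis
      using gX inj_image_eq_iff[of g] g(2)
      by (intro card_inj_on_le[of "(`) g"] finite_sets) (auto simp: bij_def inj_on_def)
  qed
  show ?thesis using le[OF y] le[OF y(2,1) y(3)[symmetric]] by (rule antisym)
qed

section \<open>Distances to stars and dual stars, and their cells\<close>

definition star :: "'v set \<Rightarrow> 'v set set" where
  "star P = {z \<in> X. P \<subseteq> z}"

text \<open>Stars are used with \<open>dim P = D - 1\<close> and dual stars with
  \<open>dim T = D + 1\<close>: the two shapes a Delsarte clique can take.\<close>

definition dual_star :: "'v set \<Rightarrow> 'v set set" where
  "dual_star T = {z \<in> X. z \<subseteq> T}"

text \<open>As \<open>P\<close> is a hyperplane of every \<open>z\<close> in the star,
  \<open>y \<inter> z\<close> exceeds \<open>y \<inter> P\<close> by at most one dimension.\<close>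

lemma gdist_set_star:
  assumes P: "subspace P" "Suc (dim P) = D" and y: "y \<in> X"
  shows "gdist_set E y (star P) = D - Suc (dim (y \<inter> P))"
  unfolding gdist_set_def
proof (rule Min_eqI)
  show "finite (gdist E y ` star P)" by (intro finite_imageI finite_sets)
  have le: "dim (y \<inter> z) \<le> Suc (dim (y \<inter> P))" if "z \<in> star P" for z
  proof -
    have z: "z \<in> X" "P \<subseteq> z" using that by (auto simp: star_def)
    have "dim (y \<inter> z) + dim P \<le> dim z + dim ((y \<inter> z) \<inter> P)"
      using z y P by (intro dim_Int_le subspace_inter) (auto simp: vertsD)
    moreover have "(y \<inter> z) \<inter> P = y \<inter> P" using z by auto
    ultimately show ?thesis using P(2) vertsD(2)[OF z(1)] by simp
  qed
  show "D - Suc (dim (y \<inter> P)) \<le> d" if "d \<in> gdist E y ` star P" for d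
  proof -
    obtain z where z: "z \<in> star P" "d = gdist E y z" using \<open>d \<in> _\<close> by auto
    then have "d = D - dim (y \<inter> z)" using gdist_eq[OF y] by (simp add: star_def)
    then show ?thesis using le[OF z(1)] by linarith
  qed
  \<comment> \<open>A vector \<open>v\<close> of \<open>y\<close> outside \<open>P\<close> gives the
    vertex \<open>span (insert v P)\<close>, which attains the bound.\<close>
  have "\<not> y \<subseteq> P" using dim_subset[of y P] P(2) vertsD(2)[OF y] by auto
  then obtain v where v: "v \<in> y" "v \<notin> P" by auto
  let ?z = "span (insert v P)"
  have z: "?z \<in> star P"
    using dim_span_insert_subspace[OF P(1) v(2)] P(2) span_superset[of "insert v P"]
    by (auto simp: star_def verts_iff)
  have "span (insert v (y \<inter> P)) \<subseteq> y \<inter> ?z"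
    using v(1) y span_superset[of "insert v P"]
    by (intro span_minimal subspace_inter subspace_span) (auto simp: vertsD)
  then have "dim (span (insert v (y \<inter> P))) \<le> dim (y \<inter> ?z)" by (rule dim_subset)
  moreover have "dim (span (insert v (y \<inter> P))) = Suc (dim (y \<inter> P))"
    using v(2) vertsD(1)[OF y] P(1) by (intro dim_span_insert_subspace subspace_inter) auto
  ultimately have "dim (y \<inter> ?z) = Suc (dim (y \<inter> P))" using le[OF z] by simp
  then have "gdist E y ?z = D - Suc (dim (y \<inter> P))"
    using gdist_eq[OF y] z by (simp add: star_def)
  then show "D - Suc (dim (y \<inter> P)) \<in> gdist E y ` star P" using z by (metis image_eqI)
qed

text \<open>Nearest to \<open>y\<close> are the members containing all of
  \<open>y \<inter> T\<close>; they exist since that intersection has dimension at most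
  \<open>D\<close>.\<close>

lemma gdist_set_dual_star:
  assumes T: "subspace T" "dim T = Suc D" and y: "y \<in> X"
  shows "gdist_set E y (dual_star T) = D - dim (y \<inter> T)"
  unfolding gdist_set_def
proof (rule Min_eqI)
  show "finite (gdist E y ` dual_star T)" by (intro finite_imageI finite_sets)
  have le: "dim (y \<inter> z) \<le> dim (y \<inter> T)" if "z \<in> dual_star T" for z
    using that by (intro dim_subset) (auto simp: dual_star_def)
  show "D - dim (y \<inter> T) \<le> d" if "d \<in> gdist E y ` dual_star T" for d
  proof -
    obtain z where z: "z \<in> dual_star T" "d = gdist E y z" using \<open>d \<in> _\<close> by auto
    then have "d = D - dim (y \<inter> z)" using gdist_eq[OF y] by (simp add: dual_star_def)
    then show ?thesis using le[OF z(1)] by linarith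
  qed
  have "dim (T \<inter> y) \<le> D" using dim_Int_verts_le[OF y] .
  then obtain z where z: "subspace z" "y \<inter> T \<subseteq> z" "z \<subseteq> T" "dim z = D"
    using exists_subspace_between[of "y \<inter> T" T D] subspace_inter[of y T] T vertsD(1)[OF y]
    by (auto simp: Int_commute)
  then have zX: "z \<in> dual_star T" by (simp add: dual_star_def verts_iff)
  have "y \<inter> z = y \<inter> T" using z by auto
  then have "gdist E y z = D - dim (y \<inter> T)"
    using gdist_eq[OF y] zX by (simp add: dual_star_def)
  then show "D - dim (y \<inter> T) \<in> gdist E y ` dual_star T" using zX by (metis image_eqI)
qed

text \<open>It remains to compare information: if labels and the intersection dimensions with a
  chain determine each other, the automorphisms fixing the chain give equitability.\<close>

lemma equitable_layers_chain:
  assumes PQ: "subspace P" "subspace Q" "P \<subseteq> Q" and "x \<in> X"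
    and layers: "\<And>y. y \<in> X \<Longrightarrow>
      \<exists>i<D. layer_pair E x C y = (i, i) \<or> layer_pair E x C y = (i, i + 1)"
    and \<kappa>: "\<And>y z. y \<in> X \<Longrightarrow> z \<in> X \<Longrightarrow> layer_pair E x C y = layer_pair E x C z
      \<longleftrightarrow> dim (y \<inter> P) = dim (z \<inter> P) \<and> dim (y \<inter> Q) = dim (z \<inter> Q)"
  shows "equitable_layers X E D x C"
proof
  show "card {z \<in> X. (y, z) \<in> E \<and> layer_pair E x C z = k}
        = card {z \<in> X. (y', z) \<in> E \<and> layer_pair E x C z = k}"
    if "y \<in> X" "y' \<in> X" "layer_pair E x C y = layer_pair E x C y'" for y y' k
    using PQ \<kappa> that by (rule card_neighbours_in_cell)
qed (use assms layers in \<open>auto simp: finite_sets edges_iff Int_commute verts_connected\<close>)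

text \<open>The chain is \<open>P \<subseteq> x\<close>. Since \<open>P\<close> is a hyperplane of
  \<open>x\<close>, \<open>y \<inter> x\<close> equals \<open>y \<inter> P\<close> in dimension (a
  plus cell) or exceeds it by one (a minus cell).\<close>

lemma equitable_layers_star:
  assumes P: "subspace P" "Suc (dim P) = D" and x: "x \<in> star P"
  shows "equitable_layers X E D x (star P)"
proof -
  have x': "x \<in> X" "P \<subseteq> x" "subspace x" using x by (auto simp: star_def vertsD)
  have \<kappa>: "layer_pair E x (star P) y = (D - Suc (dim (y \<inter> P)), D - dim (y \<inter> x))" if "y \<in> X" for y
    unfolding layer_pair_def using that x' P
    by (simp add: gdist_set_star gdist_eq Int_commute)
  have b: "dim (y \<inter> P) < D" "dim (y \<inter> x) \<le> D" "dim (y \<inter> P) \<le> dim (y \<inter> x)"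
    "dim (y \<inter> x) \<le> Suc (dim (y \<inter> P))" if "y \<in> X" for y
  proof -
    show "dim (y \<inter> P) < D" using dim_subset[of "y \<inter> P" P] P(2) by auto
    show "dim (y \<inter> x) \<le> D" using x' by (intro dim_Int_verts_le)
    show "dim (y \<inter> P) \<le> dim (y \<inter> x)" using x' by (intro dim_subset) auto
    have "dim (y \<inter> x) + dim P \<le> dim x + dim ((y \<inter> x) \<inter> P)"
      using x' that P by (intro dim_Int_le subspace_inter) (auto simp: vertsD)
    moreover have "(y \<inter> x) \<inter> P = y \<inter> P" using x' by auto
    ultimately show "dim (y \<inter> x) \<le> Suc (dim (y \<inter> P))" using P(2) vertsD(2)[OF x'(1)] by simp
  qed
  show ?thesis
  proof (rule equitable_layers_chain[OF P(1) x'(3,2,1)])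
    fix y assume y: "y \<in> X"
    have "D - dim (y \<inter> x) = D - Suc (dim (y \<inter> P)) \<or> D - dim (y \<inter> x) = D - Suc (dim (y \<inter> P)) + 1"
      using b[OF y] by linarith
    then show "\<exists>i<D. layer_pair E x (star P) y = (i, i) \<or> layer_pair E x (star P) y = (i, i + 1)"
      unfolding \<kappa>[OF y] using D_pos by (intro exI[of _ "D - Suc (dim (y \<inter> P))"]) auto
  next
    fix y z assume yz: "y \<in> X" "z \<in> X"
    show "layer_pair E x (star P) y = layer_pair E x (star P) z
      \<longleftrightarrow> dim (y \<inter> P) = dim (z \<inter> P) \<and> dim (y \<inter> x) = dim (z \<inter> x)"
      \<comment> \<open>The bounds rule out truncation, so equal differences mean equal
        dimensions.\<close>
      unfolding \<kappa>[OF yz(1)] \<kappa>[OF yz(2)] prod.inject using b(1,2)[OF yz(1)] b(1,2)[OF yz(2)]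
      by linarith
  qed
qed

text \<open>The chain is \<open>x \<subseteq> T\<close>. As \<open>D + (D + 1)\<close> exceeds
  \<open>N = 2 * D\<close>, every vertex meets \<open>T\<close> nontrivially, which keeps the layer
  index \<open>D - dim (y \<inter> T)\<close> below \<open>D\<close>.\<close>

lemma equitable_layers_dual_star:
  assumes N: "dim (UNIV :: 'v set) = 2 * D"
    and T: "subspace T" "dim T = Suc D" and x: "x \<in> dual_star T"
  shows "equitable_layers X E D x (dual_star T)"
proof -
  have x': "x \<in> X" "x \<subseteq> T" "subspace x" using x by (auto simp: dual_star_def vertsD)
  have \<kappa>: "layer_pair E x (dual_star T) y = (D - dim (y \<inter> T), D - dim (y \<inter> x))" if "y \<in> X" for y
    unfolding layer_pair_def using that x' T
    by (simp add: gdist_set_dual_star gdist_eq Int_commute)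
  have b: "0 < dim (y \<inter> T)" "dim (y \<inter> T) \<le> D" "dim (y \<inter> x) \<le> dim (y \<inter> T)"
    "dim (y \<inter> T) \<le> Suc (dim (y \<inter> x))" if "y \<in> X" for y
  proof -
    have "dim y + dim T \<le> dim (UNIV :: 'v set) + dim (y \<inter> T)"
      using that T by (intro dim_Int_le) (auto simp: vertsD)
    then show "0 < dim (y \<inter> T)" using N T(2) vertsD(2)[OF that] by linarith
    show "dim (y \<inter> T) \<le> D" using dim_Int_verts_le[OF that, of T] by (simp add: Int_commute)
    show "dim (y \<inter> x) \<le> dim (y \<inter> T)" using x' by (intro dim_subset) auto
    have "dim (y \<inter> T) + dim x \<le> dim T + dim ((y \<inter> T) \<inter> x)"
      using x' that T by (intro dim_Int_le subspace_inter) (auto simp: vertsD)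
    moreover have "(y \<inter> T) \<inter> x = y \<inter> x" using x' by auto
    ultimately show "dim (y \<inter> T) \<le> Suc (dim (y \<inter> x))" using T(2) vertsD(2)[OF x'(1)] by simp
  qed
  show ?thesis
  proof (rule equitable_layers_chain[OF x'(3) T(1) x'(2,1)])
    fix y assume y: "y \<in> X"
    have "D - dim (y \<inter> x) = D - dim (y \<inter> T) \<or> D - dim (y \<inter> x) = D - dim (y \<inter> T) + 1"
      using b[OF y] by linarith
    then show "\<exists>i<D. layer_pair E x (dual_star T) y = (i, i) \<or> layer_pair E x (dual_star T) y = (i, i + 1)"
      unfolding \<kappa>[OF y] using D_pos b(1)[OF y] by (intro exI[of _ "D - dim (y \<inter> T)"]) auto
  next
    fix y z assume yz: "y \<in> X" "z \<in> X"
    show "layer_pair E x (dual_star T) y = layer_pair E x (dual_star T) z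
      \<longleftrightarrow> dim (y \<inter> x) = dim (z \<inter> x) \<and> dim (y \<inter> T) = dim (z \<inter> T)"
      unfolding \<kappa>[OF yz(1)] \<kappa>[OF yz(2)] prod.inject using b[OF yz(1)] b[OF yz(2)]
      by linarith
  qed
qed

end

section \<open>Extreme eigenvalues and Delsarte cliques\<close>

text \<open>Used to bound the size of independent sets of vectors on \<open>X\<close> by
  \<open>card X\<close>.\<close>

lemma cvecs_in_span_deltas:
  fixes X :: "'x set"
  assumes "finite X" "v \<in> cvecs X"
  shows "v \<in> module.span cvec_scale ((\<lambda>y. char_vec {y}) ` X)"
proof -
  interpret vs: vector_space "cvec_scale :: complex \<Rightarrow> ('x \<Rightarrow> complex) \<Rightarrow> _"
    by (rule vector_space_cvec_scale)
  have "v = (\<Sum>y\<in>X. cvec_scale (v y) (char_vec {y}))"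
  proof
    fix z
    have "(\<Sum>y\<in>X. cvec_scale (v y) (char_vec {y})) z = (\<Sum>y\<in>X. if z = y then v y else 0)"
      unfolding sum_fun_apply cvec_scale_def char_vec_def by (intro sum.cong) auto
    then show "v z = (\<Sum>y\<in>X. cvec_scale (v y) (char_vec {y})) z"
      using assms by (auto simp: cvecs_def sum.delta')
  qed
  moreover have "(\<Sum>y\<in>X. cvec_scale (v y) (char_vec {y})) \<in> vs.span ((\<lambda>y. char_vec {y}) ` X)"
    by (intro vs.span_sum vs.span_scale vs.span_base) auto
  ultimately show ?thesis by metis
qed

lemma sum_cnj_mult_self:
  "(\<Sum>y\<in>X. cnj (v y) * v y) = of_real (\<Sum>y\<in>X. (cmod (v y))\<^sup>2)"
  unfolding of_real_sum by (intro sum.cong refl) (metis complex_norm_square mult.commute)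

lemma sum_cmod_squares_pos:
  assumes "finite X" "v \<in> cvecs X" "v \<noteq> 0"
  shows "(\<Sum>y\<in>X. (cmod (v y))\<^sup>2) > 0"
proof -
  obtain y where "v y \<noteq> 0" using assms(3) by (auto simp: fun_eq_iff)
  moreover from this have "y \<in> X" using assms(2) by (auto simp: cvecs_def)
  ultimately show ?thesis using assms(1) by (intro sum_pos2[of X y]) auto
qed

text \<open>Eigenvectors of the real symmetric adjacency matrix for distinct eigenvalues are orthogonal.\<close>

lemma finite_graph_eigenvalues:
  fixes X :: "'x set"
  assumes fin: "finite X" and sym: "\<And>y z. (y, z) \<in> E \<Longrightarrow> (z, y) \<in> E"
  shows "finite (graph_eigenvalues X E)"
proof -
  interpret vs: vector_space "cvec_scale :: complex \<Rightarrow> ('x \<Rightarrow> complex) \<Rightarrow> _"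
    by (rule vector_space_cvec_scale)
  let ?A = "mat_vec X (adj_mat E)"
  have "\<forall>\<theta>\<in>graph_eigenvalues X E. \<exists>v. v \<in> cvecs X \<and> v \<noteq> 0 \<and> ?A v = cvec_scale (of_real \<theta>) v"
    unfolding graph_eigenvalues_def by blast
  then obtain f where f: "\<And>\<theta>. \<theta> \<in> graph_eigenvalues X E \<Longrightarrow> f \<theta> \<in> cvecs X"
    "\<And>\<theta>. \<theta> \<in> graph_eigenvalues X E \<Longrightarrow> f \<theta> \<noteq> 0"
    "\<And>\<theta>. \<theta> \<in> graph_eigenvalues X E \<Longrightarrow> ?A (f \<theta>) = cvec_scale (of_real \<theta>) (f \<theta>)"
    by metis
  define ip where "ip u v = (\<Sum>y\<in>X. cnj (u y) * v y)" for u v :: "'x \<Rightarrow> complex"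
  have cnj_adj: "cnj (adj_mat E y z) = adj_mat E y z" for y z
    by (cases "(y, z) \<in> E") (simp_all add: adj_mat_def)
  have ip_A: "ip (?A u) v = ip u (?A v)" for u v
  proof -
    have "ip (?A u) v = (\<Sum>y\<in>X. \<Sum>z\<in>X. adj_mat E y z * cnj (u z) * v y)"
      by (simp add: ip_def mat_vec_def sum_distrib_right cnj_adj)
    also have "\<dots> = (\<Sum>z\<in>X. \<Sum>y\<in>X. adj_mat E y z * cnj (u z) * v y)"
      by (rule sum.swap)
    also have "\<dots> = (\<Sum>z\<in>X. \<Sum>y\<in>X. cnj (u z) * (adj_mat E z y * v y))"
      using sym by (intro sum.cong) (auto simp: adj_mat_def)
    also have "\<dots> = ip u (?A v)"
      by (simp add: ip_def mat_vec_def sum_distrib_left)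
    finally show ?thesis .
  qed
  have ip_scale: "ip u (cvec_scale c v) = c * ip u v" "ip (cvec_scale c u) v = cnj c * ip u v" for c u v
    by (simp_all add: ip_def cvec_scale_def sum_distrib_left ac_simps)
  have orth: "ip (f \<theta>) (f \<phi>) = 0"
    if "\<theta> \<in> graph_eigenvalues X E" "\<phi> \<in> graph_eigenvalues X E" "\<theta> \<noteq> \<phi>" for \<theta> \<phi>
  proof -
    have "of_real \<theta> * ip (f \<theta>) (f \<phi>) = of_real \<phi> * ip (f \<theta>) (f \<phi>)"
      using ip_A[of "f \<theta>" "f \<phi>"] f(3)[OF that(1)] f(3)[OF that(2)] by (simp add: ip_scale)
    with that(3) show ?thesis by simp
  qed
  have pos: "ip (f \<theta>) (f \<theta>) \<noteq> 0" if "\<theta> \<in> graph_eigenvalues X E" for \<theta>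
    unfolding ip_def sum_cnj_mult_self
    using sum_cmod_squares_pos[OF fin f(1)[OF that] f(2)[OF that]] by (simp only: of_real_eq_0_iff)
  have inj: "inj_on f (graph_eigenvalues X E)"
    using orth pos by (metis inj_onI)
  have "vs.independent (f ` graph_eigenvalues X E)"
    unfolding vs.independent_explicit_finite_subsets
  proof (intro allI impI ballI)
    fix S u w assume S: "S \<subseteq> f ` graph_eigenvalues X E" "finite S"
      and 0: "(\<Sum>v\<in>S. cvec_scale (u v) v) = 0" and w: "w \<in> S"
    \<comment> \<open>Pairing the vanishing combination with \<open>w\<close> isolates the
      coefficient of \<open>w\<close> by orthogonality.\<close>
    have "0 = ip w (\<Sum>v\<in>S. cvec_scale (u v) v)"
      unfolding 0 by (simp add: ip_def)
    also have "\<dots> = (\<Sum>y\<in>X. \<Sum>v\<in>S. cnj (w y) * cvec_scale (u v) v y)"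
      unfolding ip_def sum_fun_apply sum_distrib_left ..
    also have "\<dots> = (\<Sum>v\<in>S. ip w (cvec_scale (u v) v))"
      unfolding ip_def by (rule sum.swap)
    also have "\<dots> = (\<Sum>v\<in>S. if v = w then u w * ip w w else 0)"
    proof (rule sum.cong[OF refl])
      fix v assume "v \<in> S"
      then obtain \<theta> \<phi> where "\<theta> \<in> graph_eigenvalues X E" "v = f \<theta>"
        "\<phi> \<in> graph_eigenvalues X E" "w = f \<phi>" using S(1) w by blast
      then show "ip w (cvec_scale (u v) v) = (if v = w then u w * ip w w else 0)"
        using orth[of \<phi> \<theta>] by (cases "v = w") (auto simp: ip_scale)
    qed
    also have "\<dots> = u w * ip w w" using S(2) w by simp
    finally have "u w * ip w w = 0" by simp
    moreover have "ip w w \<noteq> 0" using S(1) w pos by auto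
    ultimately show "u w = 0" by simp
  qed
  \<comment> \<open>An independent set in the span of finitely many point indicators is
    finite.\<close>
  then have "finite (f ` graph_eigenvalues X E)"
    using vs.independent_span_bound[of "(\<lambda>y. char_vec {y}) ` X"] fin f(1) cvecs_in_span_deltas[OF fin]
    by (simp add: image_subset_iff)
  with inj show ?thesis by (simp add: finite_image_iff)
qed

text \<open>The columns \<open>c x\<close> of the system lie in a space of dimension at most
  \<open>card Y\<close>, so more than \<open>card Y\<close> of them admit a nontrivial relation,
  whose coefficients form \<open>v\<close>.\<close>

lemma underdetermined_system:
  fixes B :: "'y \<Rightarrow> 'x \<Rightarrow> complex"
  assumes fin: "finite X" "finite Y" and less: "card Y < card X"
  obtains v where "v \<in> cvecs X" "v \<noteq> 0" "\<And>y. y \<in> Y \<Longrightarrow> (\<Sum>x\<in>X. B y x * v x) = 0"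
proof -
  interpret vs: vector_space "cvec_scale :: complex \<Rightarrow> ('y \<Rightarrow> complex) \<Rightarrow> _"
    by (rule vector_space_cvec_scale)
  define c where "c x = (\<lambda>y. if y \<in> Y then B y x else 0)" for x
  show ?thesis
  proof (cases "inj_on c X")
    \<comment> \<open>Dependence of the set of columns does not see repetitions, so equal columns
      are treated apart: their difference is the relation.\<close>
    case False
    then obtain x x' where x: "x \<in> X" "x' \<in> X" "c x = c x'" "x \<noteq> x'" by (auto simp: inj_on_def)
    define v where "v z = (if z = x then 1 else if z = x' then - 1 else (0 :: complex))" for z
    show ?thesis
    proof (rule that[of v])
      show "v \<in> cvecs X" using x by (auto simp: v_def cvecs_def)
      have "v x \<noteq> 0" by (simp add: v_def)
      then show "v \<noteq> 0" by auto
      fix y assume y: "y \<in> Y"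
      have "(\<Sum>z\<in>X. B y z * v z) = (\<Sum>z\<in>{x, x'}. B y z * v z)"
        using x fin by (intro sum.mono_neutral_right) (auto simp: v_def)
      also have "\<dots> = B y x - B y x'" using x(4) by (simp add: v_def)
      also have "\<dots> = 0" using fun_cong[OF x(3), of y] y by (simp add: c_def)
      finally show "(\<Sum>z\<in>X. B y z * v z) = 0" .
    qed
  next
    case True
    have "vs.dependent (c ` X)"
    proof (rule ccontr)
      assume "\<not> vs.dependent (c ` X)"
      moreover have "c ` X \<subseteq> vs.span ((\<lambda>y. char_vec {y}) ` Y)"
        using cvecs_in_span_deltas[OF fin(2)] by (auto simp: c_def cvecs_def)
      ultimately have "card (c ` X) \<le> card ((\<lambda>y. char_vec {y} :: 'y \<Rightarrow> complex) ` Y)"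
        using vs.independent_span_bound fin(2) by blast
      also have "\<dots> \<le> card Y" using fin(2) by (rule card_image_le)
      finally show False using card_image[OF True] less by simp
    qed
    then obtain u where u: "\<exists>w\<in>c ` X. u w \<noteq> 0" "(\<Sum>w\<in>c ` X. cvec_scale (u w) w) = 0"
      using vs.dependent_finite[of "c ` X"] fin(1) by auto
    define v where "v x = (if x \<in> X then u (c x) else 0)" for x
    show ?thesis
    proof (rule that[of v])
      show "v \<in> cvecs X" by (auto simp: v_def cvecs_def)
      obtain x where "x \<in> X" "u (c x) \<noteq> 0" using u(1) by auto
      then have "v x \<noteq> 0" by (simp add: v_def)
      then show "v \<noteq> 0" by auto
      fix y assume y: "y \<in> Y"
      have "0 = (\<Sum>w\<in>c ` X. cvec_scale (u w) w) y" unfolding u(2) by simp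
      also have "\<dots> = (\<Sum>x\<in>X. u (c x) * c x y)"
        unfolding sum_fun_apply sum.reindex[OF True] by (simp add: cvec_scale_def)
      also have "\<dots> = (\<Sum>x\<in>X. B y x * v x)"
        using y by (intro sum.cong) (auto simp: c_def v_def)
      finally show "(\<Sum>x\<in>X. B y x * v x) = 0" by simp
    qed
  qed
qed

section \<open>Extreme eigenvalues of the Grassmann graph\<close>

context grassmann_graph
begin

abbreviation "N \<equiv> dim (UNIV :: 'v set)"
text \<open>In the incidence of vertices with \<open>(D - 1)\<close>-dimensional subspaces,
  \<open>a = [D]\<close> counts the subspaces in a vertex and \<open>b = [N - D + 1]\<close> the
  vertices through a subspace (for \<open>D \<le> N\<close>).\<close>

abbreviation "a \<equiv> gauss_number q D"
abbreviation "b \<equiv> gauss_number q (Suc (N - D))"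

definition subverts :: "'v set set" where
  "subverts = {H. subspace H \<and> Suc (dim H) = D}"

lemma subverts_iff: "H \<in> subverts \<longleftrightarrow> subspace H \<and> Suc (dim H) = D"
  by (simp add: subverts_def)

lemma card_subverts_below:
  assumes "z \<in> X"
  shows "card {H \<in> subverts. H \<subseteq> z} = a"
proof -
  have "{H \<in> subverts. H \<subseteq> z} = hyperplanes z"
    using vertsD(2)[OF assms] by (auto simp: hyperplanes_def subverts_iff)
  then show ?thesis using card_hyperplanes vertsD[OF assms] by simp
qed

lemma card_star:
  assumes "subspace H" "Suc (dim H) = D" "D \<le> N"
  shows "card (star H) = b"
proof -
  have "star H = {z. subspace z \<and> H \<subseteq> z \<and> z \<subseteq> UNIV \<and> dim z = Suc (dim H)}"
    using assms(2) by (auto simp: star_def verts_iff)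
  moreover have "N - dim H = Suc (N - D)" using assms(2,3) by linarith
  ultimately show ?thesis
    using card_superspaces[OF assms(1) subspace_UNIV subset_UNIV] by simp
qed

text \<open>For distinct vertices only \<open>y \<inter> z\<close> has room to be a common
  \<open>(D - 1)\<close>-dimensional subspace, and it is one exactly when they are adjacent.\<close>

lemma card_common_subverts:
  assumes "y \<in> X" "z \<in> X"
  shows "card {H \<in> subverts. H \<subseteq> y \<and> H \<subseteq> z} = (if y = z then a else of_bool ((y, z) \<in> E))"
proof (cases "y = z")
  case True
  then show ?thesis using card_subverts_below[OF assms(1)] by simp
next
  case False
  have sub: "subspace (y \<inter> z)" using assms by (intro subspace_inter) (auto simp: vertsD)
  have "dim (y \<inter> z) \<noteq> D"
  proof
    assume "dim (y \<inter> z) = D"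
    then have "y \<inter> z = y" "y \<inter> z = z"
      using assms sub by (intro subspace_eqI; auto simp: vertsD)+
    with False show False by simp
  qed
  then have lt: "dim (y \<inter> z) < D" using dim_Int_verts_le[OF assms(2), of y] by simp
  have H: "H = y \<inter> z \<and> (y, z) \<in> E" if "H \<in> subverts" "H \<subseteq> y" "H \<subseteq> z" for H
  proof -
    have "dim H \<le> dim (y \<inter> z)" using that by (intro dim_subset) auto
    then have "dim (y \<inter> z) = D - 1" "dim H = D - 1" using lt that by (auto simp: subverts_iff)
    moreover from this have "H = y \<inter> z"
      using that sub by (intro subspace_eqI) (auto simp: subverts_iff)
    ultimately show ?thesis using assms by (simp add: edges_iff)
  qed
  show ?thesis
  proof (cases "(y, z) \<in> E")
    case True
    have "{H \<in> subverts. H \<subseteq> y \<and> H \<subseteq> z} = {y \<inter> z}"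
    proof (intro equalityI subsetI)
      fix H assume "H \<in> {y \<inter> z}"
      then show "H \<in> {H \<in> subverts. H \<subseteq> y \<and> H \<subseteq> z}"
        using True sub D_pos by (auto simp: edges_iff subverts_iff)
    qed (use H in auto)
    then show ?thesis using True False by simp
  next
    case not_edge: False
    have empty: "{H \<in> subverts. H \<subseteq> y \<and> H \<subseteq> z} = {}" using H not_edge by blast
    show ?thesis unfolding empty using not_edge False by simp
  qed
qed

text \<open>
  With \<open>B\<close> the incidence matrix between vertices and \<open>(D - 1)\<close>-dimensional subspaces, this is
  the identity \<open>B B\<^sup>T = A + [D] I\<close>; it makes \<open>A + [D] I\<close> positive semidefinite.
\<close>

lemma incidence_identity:
  assumes "y \<in> X"
  shows "(\<Sum>H\<in>subverts. of_bool (H \<subseteq> y) * (\<Sum>z\<in>X. of_bool (H \<subseteq> z) * v z))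
    = mat_vec X (adj_mat E) v y + of_nat a * v y"
proof -
  have "(\<Sum>H\<in>subverts. of_bool (H \<subseteq> y) * (\<Sum>z\<in>X. of_bool (H \<subseteq> z) * v z))
      = (\<Sum>H\<in>subverts. \<Sum>z\<in>X. of_bool (H \<subseteq> y \<and> H \<subseteq> z) * v z)"
    unfolding sum_distrib_left by (intro sum.cong refl) auto
  also have "\<dots> = (\<Sum>z\<in>X. \<Sum>H\<in>subverts. of_bool (H \<subseteq> y \<and> H \<subseteq> z) * v z)"
    by (rule sum.swap)
  also have "\<dots> = (\<Sum>z\<in>X. of_nat (card {H \<in> subverts. H \<subseteq> y \<and> H \<subseteq> z}) * v z)"
  proof (rule sum.cong[OF refl])
    fix z
    have "(\<Sum>H\<in>subverts. of_bool (H \<subseteq> y \<and> H \<subseteq> z)) = (of_nat (card {H \<in> subverts. H \<subseteq> y \<and> H \<subseteq> z}) :: complex)"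
      using finite_sets[of subverts] by (simp add: of_bool_def sum.If_cases Int_def)
    then show "(\<Sum>H\<in>subverts. of_bool (H \<subseteq> y \<and> H \<subseteq> z) * v z)
        = of_nat (card {H \<in> subverts. H \<subseteq> y \<and> H \<subseteq> z}) * v z"
      by (simp only: sum_distrib_right[symmetric])
  qed
  also have "\<dots> = (\<Sum>z\<in>X. adj_mat E y z * v z + (if z = y then of_nat a * v y else 0))"
  proof (rule sum.cong[OF refl])
    fix z assume "z \<in> X"
    moreover have "(y, y) \<notin> E" using vertsD(2)[OF assms] D_pos by (auto simp: edges_iff)
    ultimately show "of_nat (card {H \<in> subverts. H \<subseteq> y \<and> H \<subseteq> z}) * v z
        = adj_mat E y z * v z + (if z = y then of_nat a * v y else 0)"
      using assms
      by (cases "z = y") (simp_all add: card_common_subverts card_subverts_below adj_mat_def)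
  qed
  also have "\<dots> = mat_vec X (adj_mat E) v y + of_nat a * v y"
    using assms finite_sets[of X] by (simp add: sum.distrib mat_vec_def)
  finally show ?thesis .
qed

text \<open>For an eigenvector \<open>v\<close>, \<open>s\<close> is the incidence transpose applied
  to \<open>v\<close>, and \<open>\<theta> + a\<close> times the squared norm of \<open>v\<close> is
  the squared norm of \<open>s\<close>.\<close>

lemma eigenvalue_ge:
  assumes "\<theta> \<in> graph_eigenvalues X E"
  shows "- real a \<le> \<theta>"
proof -
  obtain v where v: "v \<in> cvecs X" "v \<noteq> 0" "mat_vec X (adj_mat E) v = cvec_scale (of_real \<theta>) v"
    using assms unfolding graph_eigenvalues_def by blast
  define s where "s H = (\<Sum>z\<in>X. of_bool (H \<subseteq> z) * v z)" for H
  have "of_real ((\<theta> + real a) * (\<Sum>y\<in>X. (cmod (v y))\<^sup>2))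
      = (\<Sum>y\<in>X. cnj (v y) * (mat_vec X (adj_mat E) v y + of_nat a * v y))"
  proof -
    have "of_real ((\<theta> + real a) * (\<Sum>y\<in>X. (cmod (v y))\<^sup>2))
        = of_real (\<theta> + real a) * (\<Sum>y\<in>X. cnj (v y) * v y)"
      by (simp only: of_real_mult sum_cnj_mult_self)
    also have "\<dots> = (\<Sum>y\<in>X. of_real (\<theta> + real a) * (cnj (v y) * v y))"
      by (rule sum_distrib_left)
    also have "\<dots> = (\<Sum>y\<in>X. cnj (v y) * (mat_vec X (adj_mat E) v y + of_nat a * v y))"
      unfolding v(3) by (intro sum.cong refl) (simp add: cvec_scale_def algebra_simps)
    finally show ?thesis .
  qed
  also have "\<dots> = (\<Sum>y\<in>X. \<Sum>H\<in>subverts. cnj (v y) * (of_bool (H \<subseteq> y) * s H))"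
    unfolding sum_distrib_left[symmetric] s_def by (intro sum.cong refl) (simp add: incidence_identity)
  also have "\<dots> = (\<Sum>H\<in>subverts. \<Sum>y\<in>X. cnj (v y) * (of_bool (H \<subseteq> y) * s H))"
    by (rule sum.swap)
  also have "\<dots> = (\<Sum>H\<in>subverts. cnj (s H) * s H)"
  proof (rule sum.cong[OF refl])
    fix H
    have "cnj (s H) = (\<Sum>y\<in>X. of_bool (H \<subseteq> y) * cnj (v y))"
      unfolding s_def cnj_sum by (intro sum.cong refl) auto
    then show "(\<Sum>y\<in>X. cnj (v y) * (of_bool (H \<subseteq> y) * s H)) = cnj (s H) * s H"
      by (simp add: sum_distrib_left ac_simps)
  qed
  also have "\<dots> = of_real (\<Sum>H\<in>subverts. (cmod (s H))\<^sup>2)"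
    by (rule sum_cnj_mult_self)
  finally have "(\<theta> + real a) * (\<Sum>y\<in>X. (cmod (v y))\<^sup>2) = (\<Sum>H\<in>subverts. (cmod (s H))\<^sup>2)"
    by (simp only: of_real_eq_iff)
  also have "\<dots> \<ge> 0" by (intro sum_nonneg) auto
  finally have "0 \<le> (\<theta> + real a) * (\<Sum>y\<in>X. (cmod (v y))\<^sup>2)" .
  then have "0 \<le> \<theta> + real a"
    using sum_cmod_squares_pos[OF finite_sets v(1,2)] by (simp add: zero_le_mult_iff)
  then show ?thesis by simp
qed

text \<open>Incident pairs are counted from both sides.\<close>

lemma card_verts_incidences:
  assumes "D \<le> N"
  shows "card X * a = card subverts * b"
proof -
  have "card X * a = (\<Sum>z\<in>X. card {H \<in> subverts. H \<subseteq> z})"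
    by (simp add: card_subverts_below)
  also have "\<dots> = (\<Sum>z\<in>X. \<Sum>H\<in>subverts. of_bool (H \<subseteq> z))"
    using finite_sets[of subverts] by (simp add: of_bool_def sum.If_cases Int_def)
  also have "\<dots> = (\<Sum>H\<in>subverts. \<Sum>z\<in>X. of_bool (H \<subseteq> z))"
    by (rule sum.swap)
  also have "\<dots> = (\<Sum>H\<in>subverts. card (star H))"
    using finite_sets[of X] by (simp add: of_bool_def sum.If_cases Int_def star_def)
  also have "\<dots> = card subverts * b"
    using assms by (simp add: card_star subverts_iff)
  finally show ?thesis .
qed

lemma a_pos: "a > 0"
  using D_pos by (rule gauss_number_pos)

text \<open>\<open>N \<ge> 2 * D\<close> gives \<open>a < b\<close>, hence fewer
  \<open>(D - 1)\<close>-dimensional subspaces than vertices. Some nonzero \<open>v\<close> is then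
  killed by the incidence transpose, and the incidence identity turns this into
  \<open>A v = - a v\<close>.\<close>

lemma least_eigenvalue:
  assumes "2 * D \<le> N" "X \<noteq> {}"
  shows "- real a \<in> graph_eigenvalues X E"
proof -
  have "a < b" using assms(1) q_gt_1 by (intro gauss_number_less) auto
  have "0 < card X" using assms(2) finite_sets[of X] by (simp add: card_gt_0_iff)
  have "card subverts < card X"
  proof (rule ccontr)
    assume "\<not> card subverts < card X"
    then have "card X * b \<le> card subverts * b" by simp
    also have "\<dots> = card X * a" using card_verts_incidences assms(1) by simp
    finally show False using \<open>0 < card X\<close> \<open>a < b\<close> by simp
  qed
  from underdetermined_system[OF finite_sets finite_sets this, of "\<lambda>H z. of_bool (H \<subseteq> z)"]
  obtain v where v: "v \<in> cvecs X" "v \<noteq> 0"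
    "\<And>H. H \<in> subverts \<Longrightarrow> (\<Sum>z\<in>X. of_bool (H \<subseteq> z) * v z) = 0"
    by blast
  have "mat_vec X (adj_mat E) v = cvec_scale (of_real (- real a)) v"
  proof
    fix y
    show "mat_vec X (adj_mat E) v y = cvec_scale (of_real (- real a)) v y"
    proof (cases "y \<in> X")
      case True
      have "mat_vec X (adj_mat E) v y + of_nat a * v y = 0"
        unfolding incidence_identity[OF True, symmetric] using v(3) by (intro sum.neutral) auto
      then show ?thesis by (simp add: cvec_scale_def eq_neg_iff_add_eq_0)
    next
      case False
      then have "mat_vec X (adj_mat E) v y = 0"
        unfolding mat_vec_def adj_mat_def by (intro sum.neutral) (auto simp: edges_iff)
      then show ?thesis using False v(1) by (simp add: cvec_scale_def cvecs_def)
    qed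
  qed
  then show ?thesis using v unfolding graph_eigenvalues_def by blast
qed

text \<open>The incidence identity at the all-ones vector: \<open>a\<close> subspaces below
  \<open>y\<close>, each in \<open>b\<close> vertices, so the graph is regular of degree
  \<open>a * b - a\<close>.\<close>

lemma adj_mat_ones:
  assumes "y \<in> X" "D \<le> N"
  shows "mat_vec X (adj_mat E) (char_vec X) y = of_real (real a * real b - real a)"
proof -
  have "mat_vec X (adj_mat E) (char_vec X) y + of_nat a
      = (\<Sum>H\<in>subverts. of_bool (H \<subseteq> y) * (\<Sum>z\<in>X. of_bool (H \<subseteq> z) * char_vec X z))"
    using incidence_identity[OF assms(1), of "char_vec X"] assms(1) by (simp add: char_vec_def)
  also have "\<dots> = (\<Sum>H\<in>subverts. of_bool (H \<subseteq> y) * of_nat b)"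
  proof (rule sum.cong[OF refl])
    fix H assume "H \<in> subverts"
    then have "card (star H) = b" using assms(2) by (simp add: card_star subverts_iff)
    moreover have "(\<Sum>z\<in>X. of_bool (H \<subseteq> z) * char_vec X z) = of_nat (card (star H))"
      using finite_sets[of X] by (simp add: char_vec_def star_def of_bool_def sum.If_cases Int_def)
    ultimately show "of_bool (H \<subseteq> y) * (\<Sum>z\<in>X. of_bool (H \<subseteq> z) * char_vec X z) = of_bool (H \<subseteq> y) * of_nat b"
      by simp
  qed
  also have "\<dots> = of_nat (card {H \<in> subverts. H \<subseteq> y}) * of_nat b"
    using finite_sets[of subverts] by (simp add: sum_distrib_right[symmetric] of_bool_def sum.If_cases Int_def)
  also have "\<dots> = of_nat a * of_nat b"
    using assms(1) by (simp add: card_subverts_below)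
  finally show ?thesis by (simp add: eq_diff_eq)
qed

lemma greatest_eigenvalue:
  assumes "D \<le> N" "X \<noteq> {}"
  shows "real a * real b - real a \<in> graph_eigenvalues X E"
proof -
  have "mat_vec X (adj_mat E) (char_vec X) = cvec_scale (of_real (real a * real b - real a)) (char_vec X)"
  proof
    fix y
    show "mat_vec X (adj_mat E) (char_vec X) y = cvec_scale (of_real (real a * real b - real a)) (char_vec X) y"
    proof (cases "y \<in> X")
      case True
      then show ?thesis using adj_mat_ones[OF True assms(1)] by (simp add: cvec_scale_def char_vec_def)
    next
      case False
      then have "mat_vec X (adj_mat E) (char_vec X) y = 0"
        unfolding mat_vec_def adj_mat_def by (intro sum.neutral) (auto simp: edges_iff)
      then show ?thesis using False by (simp add: cvec_scale_def char_vec_def)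
    qed
  qed
  moreover obtain x where "x \<in> X" using assms(2) by auto
  then have "char_vec X x \<noteq> 0" by (simp add: char_vec_def)
  then have "char_vec X \<noteq> 0" by auto
  moreover have "char_vec X \<in> cvecs X" by (simp add: cvecs_def char_vec_def)
  ultimately show ?thesis unfolding graph_eigenvalues_def by blast
qed

text \<open>At a vertex where an eigenvector has its largest modulus, the triangle inequality bounds
  the eigenvalue by the degree.\<close>

lemma eigenvalue_le:
  assumes "\<theta> \<in> graph_eigenvalues X E" "D \<le> N"
  shows "\<theta> \<le> real a * real b - real a"
proof -
  obtain v where v: "v \<in> cvecs X" "v \<noteq> 0" "mat_vec X (adj_mat E) v = cvec_scale (of_real \<theta>) v"
    using assms unfolding graph_eigenvalues_def by blast
  define m where "m = Max ((\<lambda>y. cmod (v y)) ` X)"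
  obtain w where w: "v w \<noteq> 0" using v(2) by (auto simp: fun_eq_iff)
  then have wX: "w \<in> X" using v(1) by (auto simp: cvecs_def)
  have le: "cmod (v z) \<le> m" if "z \<in> X" for z
    unfolding m_def using that finite_sets[of X] by (intro Max_ge) auto
  have "m \<in> (\<lambda>y. cmod (v y)) ` X"
    unfolding m_def using wX finite_sets[of X] by (intro Max_in) auto
  then obtain y where y: "y \<in> X" "cmod (v y) = m" by auto
  have m: "m > 0" using le[OF wX] w by (smt (verit) zero_less_norm_iff)
  have "\<theta> * m \<le> \<bar>\<theta>\<bar> * m" using m by (intro mult_right_mono) auto
  also have "\<dots> = cmod (mat_vec X (adj_mat E) v y)"
    unfolding v(3) by (simp add: cvec_scale_def norm_mult y(2))
  also have "\<dots> \<le> (\<Sum>z\<in>X. cmod (adj_mat E y z * v z))"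
    unfolding mat_vec_def by (rule norm_sum)
  also have "\<dots> \<le> (\<Sum>z\<in>X. of_bool ((y, z) \<in> E) * m)"
    using le by (intro sum_mono) (auto simp: adj_mat_def norm_mult)
  also have "\<dots> = (\<Sum>z\<in>X. of_bool ((y, z) \<in> E)) * m"
    by (rule sum_distrib_right[symmetric])
  also have "(\<Sum>z\<in>X. of_bool ((y, z) \<in> E)) = real a * real b - real a"
  proof -
    have "of_real (\<Sum>z\<in>X. of_bool ((y, z) \<in> E)) = mat_vec X (adj_mat E) (char_vec X) y"
      unfolding mat_vec_def adj_mat_def char_vec_def of_real_sum by (intro sum.cong) auto
    then show ?thesis using adj_mat_ones[OF y(1) assms(2)] by (simp only: of_real_eq_iff)
  qed
  finally show ?thesis using m by simp
qed

lemma delsarte_clique_card: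
  assumes "delsarte_clique X E C" "2 * D \<le> N" "X \<noteq> {}"
  shows "card C = b"
proof -
  \<comment> \<open>Finiteness is required before \<open>Max\<close> and \<open>Min\<close> carry
    their meaning.\<close>
  have fin: "finite (graph_eigenvalues X E)"
    using finite_sets edges_sym by (rule finite_graph_eigenvalues)
  have "D \<le> N" using assms(2) by linarith
  then have max: "Max (graph_eigenvalues X E) = real a * real b - real a"
    using fin assms(3) eigenvalue_le greatest_eigenvalue by (intro Max_eqI) simp_all
  have min: "Min (graph_eigenvalues X E) = - real a"
    using fin assms(2,3) eigenvalue_ge least_eigenvalue by (intro Min_eqI) simp_all
  have "real (card C) = 1 - (real a * real b - real a) / - real a"
    using assms(1) unfolding delsarte_clique_def max min by blast
  also have "\<dots> = real b" using a_pos by (simp add: field_simps)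
  finally show ?thesis by simp
qed

section \<open>Classification of Delsarte cliques\<close>

lemma card_dual_star:
  assumes "subspace T" "dim T = Suc D"
  shows "card (dual_star T) = gauss_number q (Suc D)"
proof -
  have "dual_star T = hyperplanes T"
    using assms(2) by (auto simp: dual_star_def hyperplanes_def verts_iff)
  then show ?thesis using card_hyperplanes[OF assms(1)] assms(2) by simp
qed

text \<open>\<open>w \<inter> y\<close> and \<open>w \<inter> z\<close> are hyperplanes of
  \<open>w\<close>. If they coincide they equal \<open>y \<inter> z\<close>; otherwise together they
  span \<open>w\<close>.\<close>

lemma common_neighbour:
  assumes "(y, z) \<in> E" "(w, y) \<in> E" "(w, z) \<in> E"
  shows "y \<inter> z \<subseteq> w \<or> w \<subseteq> span (y \<union> z)"
proof (cases "w \<inter> y = w \<inter> z")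
  case True
  have "w \<inter> y = y \<inter> z"
    using assms True vertsD(1) by (intro subspace_eqI subspace_inter) (auto simp: edges_iff)
  then show ?thesis by auto
next
  case False
  have w: "w \<in> X" "y \<in> X" "z \<in> X" "dim (w \<inter> y) = D - 1" "dim (w \<inter> z) = D - 1"
    using assms by (auto simp: edges_iff)
  have sub: "subspace (w \<inter> y)" "subspace (w \<inter> z)" "subspace w"
    using w by (auto intro!: subspace_inter simp: vertsD)
  let ?S = "span ((w \<inter> y) \<union> (w \<inter> z))"
  have "w \<inter> y \<subset> ?S"
  proof (rule psubsetI)
    show "w \<inter> y \<noteq> ?S"
    proof
      assume eq: "w \<inter> y = ?S"
      have "w \<inter> z \<subseteq> ?S" using span_superset[of "(w \<inter> y) \<union> (w \<inter> z)"] by auto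
      then have "w \<inter> z = w \<inter> y" using eq sub w(4,5) by (intro subspace_eqI) auto
      with False show False by simp
    qed
  qed (use span_superset[of "(w \<inter> y) \<union> (w \<inter> z)"] in auto)
  then have "D - 1 < dim ?S" using dim_strict_mono[OF sub(1) subspace_span] w(4) by metis
  moreover have "?S \<subseteq> w" using sub by (intro span_minimal) auto
  ultimately have "?S = w"
    using sub vertsD(2)[OF w(1)] by (intro subspace_eqI subspace_span) auto
  moreover have "?S \<subseteq> span (y \<union> z)" by (intro span_mono) auto
  ultimately show ?thesis by simp
qed

text \<open>Each member contains \<open>y \<inter> z\<close> or lies in
  \<open>span (y \<union> z)\<close>. A single member \<open>u\<close> outside that span forces all
  others through \<open>y \<inter> z\<close>.\<close>

lemma clique_in_star_or_dual_star:
  assumes C: "is_clique X E C" and yz: "y \<in> C" "z \<in> C" "y \<noteq> z"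
  shows "C \<subseteq> star (y \<inter> z) \<or> C \<subseteq> dual_star (span (y \<union> z))"
proof (rule disjCI)
  let ?T = "span (y \<union> z)"
  have CX: "C \<subseteq> X" and adj: "\<And>u w. u \<in> C \<Longrightarrow> w \<in> C \<Longrightarrow> u \<noteq> w \<Longrightarrow> (u, w) \<in> E"
    using C by (auto simp: is_clique_def)
  have dich: "y \<inter> z \<subseteq> u \<or> u \<subseteq> ?T" if "u \<in> C" for u
  proof (cases "u = y \<or> u = z")
    case False
    then show ?thesis using that yz adj by (intro common_neighbour) auto
  qed auto
  assume "\<not> C \<subseteq> dual_star ?T"
  then obtain u where u: "u \<in> C" "\<not> u \<subseteq> ?T" using CX by (auto simp: dual_star_def)
  then have uS: "y \<inter> z \<subseteq> u" using dich by blast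
  have X: "u \<in> X" "y \<in> X" "z \<in> X" using u yz CX by auto
  have yz_dim: "dim (y \<inter> z) = D - 1" using adj[OF yz] by (simp add: edges_iff)
  \<comment> \<open>\<open>u\<close> meets \<open>?T\<close> exactly in \<open>y \<inter> z\<close>,
    so a member \<open>w\<close> inside \<open>?T\<close> can share a
    \<open>(D - 1)\<close>-dimensional subspace with \<open>u\<close> only if that subspace is
    \<open>y \<inter> z\<close>.\<close>
  have "y \<inter> z \<subseteq> u \<inter> ?T" using uS span_superset[of "y \<union> z"] by auto
  moreover have "dim (u \<inter> ?T) < D"
    using dim_strict_mono[of "u \<inter> ?T" u] u(2) X(1) by (auto simp: vertsD subspace_inter)
  ultimately have uT: "y \<inter> z = u \<inter> ?T"
    using X yz_dim by (intro subspace_eqI subspace_inter subspace_span) (auto simp: vertsD)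
  have "y \<inter> z \<subseteq> w" if w: "w \<in> C" for w
  proof (rule ccontr)
    assume not: "\<not> y \<inter> z \<subseteq> w"
    then have wT: "w \<subseteq> ?T" using dich w by blast
    then have "(u, w) \<in> E" using u w adj by blast
    then have "dim (u \<inter> w) = D - 1" by (simp add: edges_iff)
    moreover have "u \<inter> w \<subseteq> y \<inter> z" unfolding uT using wT by auto
    ultimately have "u \<inter> w = y \<inter> z"
      using X w CX yz_dim by (intro subspace_eqI subspace_inter) (auto simp: vertsD)
    with not show False by blast
  qed
  then show "C \<subseteq> star (y \<inter> z)" using CX by (auto simp: star_def)
qed

text \<open>Containment becomes equality by counting: a star has \<open>b\<close> elements and a
  dual star \<open>[D + 1]\<close>, and \<open>b \<le> [D + 1]\<close> leaves only
  \<open>N = 2 * D\<close>.\<close>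

lemma delsarte_clique_cases:
  assumes C: "delsarte_clique X E C" and N: "2 * D \<le> N" and x: "x \<in> C"
  obtains (star) P where "subspace P" "Suc (dim P) = D" "C = star P"
    | (dual_star) T where "subspace T" "dim T = Suc D" "C = dual_star T" "N = 2 * D"
proof -
  have cl: "is_clique X E C" using C by (simp add: delsarte_clique_def)
  then have CX: "C \<subseteq> X" by (simp add: is_clique_def)
  then have card_C: "card C = b" using x C N by (intro delsarte_clique_card) auto
  \<comment> \<open>This supplies a second vertex \<open>y\<close> of \<open>C\<close>, needed to
    name the star or dual star.\<close>
  have "1 < b"
    using gauss_number_less[of q 1 "Suc (N - D)"] q_gt_1 N D_pos by (simp add: gauss_number_Suc)
  then have "C \<noteq> {x}" using card_C by auto
  then obtain y where y: "y \<in> C" "y \<noteq> x" using x by blast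
  have X: "x \<in> X" "y \<in> X" using x y CX by auto
  have xy: "dim (x \<inter> y) = D - 1" using cl x y by (auto simp: is_clique_def edges_iff)
  have sub: "subspace (x \<inter> y)" "subspace (span (x \<union> y))"
    using X by (auto intro: subspace_inter simp: vertsD)
  have T: "dim (span (x \<union> y)) = Suc D"
    using dim_span_Un[of x y] X xy D_pos by (simp add: vertsD)
  from clique_in_star_or_dual_star[OF cl x y(1) y(2)[symmetric]] show thesis
  proof
    assume "C \<subseteq> star (x \<inter> y)"
    moreover have "card (star (x \<inter> y)) = b" using sub xy N D_pos by (intro card_star) auto
    ultimately have "C = star (x \<inter> y)" using card_C finite_sets by (intro card_subset_eq) auto
    then show thesis using star[of "x \<inter> y"] sub xy D_pos by simp
  next
    assume sub': "C \<subseteq> dual_star (span (x \<union> y))"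
    then have le: "b \<le> gauss_number q (Suc D)"
      using card_mono[OF finite_sets sub'] card_C card_dual_star[OF sub(2) T] by simp
    have ND: "N = 2 * D"
    proof (rule ccontr)
      assume "N \<noteq> 2 * D"
      then have "gauss_number q (Suc D) < b"
        using N q_gt_1 by (intro gauss_number_less) auto
      with le show False by simp
    qed
    then have "C = dual_star (span (x \<union> y))"
      using card_C sub' finite_sets card_dual_star[OF sub(2) T] by (intro card_subset_eq) auto
    then show thesis using dual_star sub(2) T ND by blast
  qed
qed

lemma irreducible_delsarte_clique:
  assumes "delsarte_clique X E C" "2 * D \<le> N" "x \<in> C"
  shows "irreducible_alg_module X (terwilliger_algebra X E D x C) (primary_space X E D x C)"
proof -
  have "equitable_layers X E D x C"
    using assms
  proof (cases rule: delsarte_clique_cases)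
    case (star P)
    then show ?thesis using equitable_layers_star assms(3) by blast
  next
    case (dual_star T)
    then show ?thesis using equitable_layers_dual_star assms(3) by blast
  qed
  then show ?thesis by (rule equitable_layers.irreducible_primary_space)
qed

end

theorem lemma4p3:
  fixes scale :: "'f::{field,finite} \<Rightarrow> 'v::ab_group_add \<Rightarrow> 'v"
    and q N D :: nat
    and C :: "'v set set" and x :: "'v set"
  assumes "primepow q" and "CARD('f) = q"
    and "vector_space scale" and "vector_space.dim scale (UNIV :: 'v set) = N"
    and "D \<ge> 3" and "N \<ge> 2 * D"
    and "delsarte_clique (grassmann_verts scale D) (grassmann_edges scale D) C"
    and "x \<in> C"
  shows "irreducible_alg_module (grassmann_verts scale D)
           (terwilliger_algebra (grassmann_verts scale D) (grassmann_edges scale D) D x C)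
           (primary_space (grassmann_verts scale D) (grassmann_edges scale D) D x C)"
proof -
  interpret vector_space scale by (rule assms(3))
  obtain B where B: "independent B" "UNIV \<subseteq> span B" "card B = dim (UNIV :: 'v set)"
    by (rule basis_exists)
  \<comment> \<open>Infinite sets have \<open>card\<close> zero, so the positive cardinality
    \<open>N\<close> of \<open>B\<close> yields finiteness.\<close>
  then have "finite B" using assms(4-6) by (intro card_ge_0_finite) linarith
  then interpret grassmann_graph scale B q D
    using B assms(2,5) by unfold_locales auto
  show ?thesis
    using assms(4,6-8) by (intro irreducible_delsarte_clique) simp_all
qed

end
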